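(* Let $k\ge 1$ be an integer. There is a finite set $E_k$ of primes such that the following holds. Let $n>1$ be an integer such that $r=nk+1$ is a prime with $r\notin E_k$, let $q$ be a power of a prime $p$ with $r\nmid q$, let $K$ be the unique subgroup of $\mathbb Z_r^*$ of order $k$, and assume $\langle q,K\rangle=\mathbb Z_r^*$. Then $t_{ij}\le 2$ for all $0\le i,j\le n-1$, and $C(n,k;q)$ is given by the following formulas. (i) If $k$ is even, \[ C(n,k;q)= \begin{cases} nk-k^2+3k-3&\text{if } p=2,\\ nk-\frac 12 k^2+\frac 32k-2&\text{if } p>2 \text{ and } k\equiv 0\pmod p,\\ n(k+1)-\frac 12k^2+k-3&\text{if } p>2 \text{ and } k\equiv 1\pmod p,\\ n(k+1)-\frac 12k^2+\frac 12k-1&\text{if } p>2 \text{ and } k\equiv 2\pmod p,\\ n(k+1)-\frac 12k^2+k-2&\text{if } p>2 \text{ and } k\not\equiv 0,1,2\pmod p. \end{cases} \] (ii) If $k$ is odd, \[ C(n,k;q)= \begin{cases} n(k+1)-k^2+k-1&\text{if } p=2,\\ nk-\frac 12 k^2+\frac 32k-2&\text{if } p>2 \text{ and } k\equiv 0\pmod p,\\ n(k+1)-\frac 12k^2-\frac 12 k&\text{if } p>2 \text{ and } k\equiv 1\pmod p,\\ n(k+1)-\frac 12k^2+\frac 12 k-1&\text{if } p>2 \text{ and } k\not\equiv 0,1\pmod p. \end{cases} \]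
   Context: $\mathbb Z_r=\mathbb Z/r\mathbb Z$ and $\mathbb Z_r^*$ is its multiplicative group. $\langle q,K\rangle$ denotes the subgroup of $\mathbb Z_r^*$ generated by the class of $q$ and $K$; when it equals $\mathbb Z_r^*$, the cosets $q^iK$, $0\le i\le n-1$, are exactly the $n$ distinct cosets of $K$ in $\mathbb Z_r^*$. The cyclotomic numbers are \[ t_{ij}=|(1+q^iK)\cap q^jK|,\quad 0\le i,j\le n-1 . \] Put $\delta_i=1$ if $k$ is even and $i=0$, or if $k$ is odd and $i=n/2$ (if $k$ is odd then $n$ is even); put $\delta_i=0$ otherwise. With $p=\operatorname{char}\mathbb F_q$, \[ C(n,k;q)=\bigl|\{(i,j):0\le i,j\le n-1,\ t_{ij}-k\delta_i\not\equiv 0\pmod p\}\bigr| . \] (This is the complexity of the normal basis $\alpha_0,\dots,\alpha_{n-1}$ of $\mathbb F_{q^n}$ over $\mathbb F_q$ formed by the Gauss periods $\alpha_i=\sum_{a\in K}\gamma^{q^ia}$, where $\gamma\in\mathbb F_{q^{nk}}^*$ has multiplicative order $r$.) *)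

theory Defs
  imports
    "HOL-Number_Theory.Residues"
    "HOL-Algebra.Generated_Groups"
    "HOL-Algebra.AbelCoset"
    Complex_Main
begin

text \<open>For prime \<open>r\<close>, the elements of \<open>\<int>/r\<int>\<close> are represented by the integers \<open>0, \<dots>, r - 1\<close>.\<close>

abbreviation Zmod :: "nat \<Rightarrow> int ring" where
  "Zmod r \<equiv> residue_ring (int r)"

abbreviation Zmod_units :: "nat \<Rightarrow> int monoid" where
  "Zmod_units r \<equiv> units_of (Zmod r)"

definition residue_class :: "nat \<Rightarrow> nat \<Rightarrow> int" where
  "residue_class r q = int q mod int r"

definition coset_q :: "nat \<Rightarrow> nat \<Rightarrow> int set \<Rightarrow> nat \<Rightarrow> int set" where
  "coset_q r q K i =
     (residue_class r q [^]\<^bsub>Zmod_units r\<^esub> i) <#\<^bsub>Zmod_units r\<^esub> K"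

definition cyclotomic_number :: "nat \<Rightarrow> nat \<Rightarrow> int set \<Rightarrow> nat \<Rightarrow> nat \<Rightarrow> nat" where
  "cyclotomic_number r q K i j =
     card ((\<one>\<^bsub>Zmod r\<^esub> <+\<^bsub>Zmod r\<^esub> coset_q r q K i) \<inter> coset_q r q K j)"

definition delta :: "nat \<Rightarrow> nat \<Rightarrow> nat \<Rightarrow> nat" where
  "delta n k i = (if (even k \<and> i = 0) \<or> (odd k \<and> 2 * i = n) then 1 else 0)"

text \<open>
  The number \<open>C(n, k; q)\<close>, with \<open>r = n k + 1\<close>. The argument \<open>p\<close> is the characteristic of the
  field with \<open>q\<close> elements, i.e. the prime of which \<open>q\<close> is a power. The difference is taken in the
  integers, since it may be negative.
\<close>

definition complexity :: "nat \<Rightarrow> nat \<Rightarrow> nat \<Rightarrow> nat \<Rightarrow> int set \<Rightarrow> nat" where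
  "complexity n k p q K =
     card {(i, j). i < n \<and> j < n \<and>
       \<not> [int (cyclotomic_number (n * k + 1) q K i j) - int k * int (delta n k i) = 0] (mod int p)}"

end

theory Submission
  imports
    Defs
    "HOL-Computational_Algebra.Field_as_Ring"
    "HOL-Computational_Algebra.Polynomial_Factorial"
    "HOL-Computational_Algebra.Fundamental_Theorem_Algebra"
    "HOL-Number_Theory.Residue_Primitive_Roots"
begin

text \<open>
  An element \<open>x\<close> with \<open>x, 1 + x\<close> nonzero modulo \<open>r\<close> contributes to the cyclotomic number \<open>t i j\<close> for
  exactly one cell \<open>(i, j)\<close>, namely the one with \<open>x \<in> q\<^sup>i K\<close> and \<open>1 + x \<in> q\<^sup>j K\<close>. There are
  \<open>n k - 1\<close> such \<open>x\<close>, and the proof is a count of coincidences between cells. If \<open>x \<noteq> y\<close> share a cell,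
  then \<open>y = u x\<close> and \<open>1 + y = v (1 + x)\<close> with \<open>u, v \<in> K\<close>; here \<open>1, u, v\<close> are distinct, and conversely
  such \<open>u, v\<close> determine \<open>x = (v - 1) / (u - v)\<close>. So there are exactly \<open>(k - 1) (k - 2)\<close> ordered
  coincidences (\<open>card_pairs\<close>).

  A third element of the same cell would give a second pair with
  \<open>(v - 1) (u' - 1) = (v' - 1) (u - 1)\<close>. For complex roots of unity this says that the triangles
  \<open>1, u, v\<close> and \<open>1, u', v'\<close> inscribed in the unit circle are directly similar with common vertex \<open>1\<close>;
  then they are equal, as complex conjugation shows (\<open>similar_triangles_on_unit_circle\<close>).
  A relation between roots of unity that fails over the complex numbers fails modulo \<open>r\<close> for all but
  finitely many primes \<open>r\<close>, by a Bezout identity with integer coefficients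
  (\<open>no_root_of_exact_order\<close>). Hence outside a finite set of primes no cell has three elements
  (\<open>no_three_with_equal_powers\<close>). With \<open>t \<le> 2\<close>, the number of elements and the
  number of coincidences fix how many cells have \<open>t = 1\<close> and how many have \<open>t = 2\<close>.

  The correction \<open>k \<delta>\<^sub>i\<close> only affects the row \<open>i\<close> with \<open>-1 \<in> q\<^sup>i K\<close>, so this row
  is counted separately; it has \<open>k - 1\<close> elements. Inversion \<open>x \<mapsto> 1 / x\<close> multiplies \<open>1 + x\<close> by \<open>1 / x\<close>.
  For even \<open>k\<close> it therefore preserves the cells of this row, which are the pairs \<open>{x, 1 / x}\<close> and the
  singleton \<open>{1}\<close>. For odd \<open>k\<close>, comparing with the subgroup \<open>\<plusminus>K\<close> of order \<open>2 k\<close>, in which the same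
  argument applies, shows that no two elements of the row share a cell. That is why primes are also
  excluded with respect to \<open>2 k\<close>. The formulas result by collecting, for each residue of \<open>k\<close> modulo
  \<open>p\<close>, which values \<open>0, 1, 2\<close> become nonzero modulo \<open>p\<close>.

  Since \<open>K\<close> is the group of \<open>k\<close>-th roots of unity modulo \<open>r\<close>, two units lie in the same coset iff
  their \<open>k\<close>-th powers agree. All arguments are phrased with such power congruences.
\<close>

section \<open>Reduction of relations between roots of unity modulo primes\<close>

lemma map_poly_hom_add:
  fixes \<phi> :: "'a::comm_ring_1 \<Rightarrow> 'b::comm_ring_1"
  assumes "\<phi> 0 = 0" "\<And>x y. \<phi> (x + y) = \<phi> x + \<phi> y"
  shows "map_poly \<phi> (p + q) = map_poly \<phi> p + map_poly \<phi> q"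
  by (intro poly_eqI) (simp add: coeff_map_poly assms)

lemma map_poly_hom_mult:
  fixes \<phi> :: "'a::comm_ring_1 \<Rightarrow> 'b::comm_ring_1"
  assumes "\<phi> 0 = 0" "\<And>x y. \<phi> (x + y) = \<phi> x + \<phi> y" "\<And>x y. \<phi> (x * y) = \<phi> x * \<phi> y"
  shows "map_poly \<phi> (p * q) = map_poly \<phi> p * map_poly \<phi> q"
proof -
  have "\<phi> (sum f A) = (\<Sum>x\<in>A. \<phi> (f x))" if "finite A" for f and A :: "nat set"
    using that by (induction A) (simp_all add: assms)
  then show ?thesis
    by (intro poly_eqI) (simp add: coeff_map_poly coeff_mult assms)
qed

lemma map_poly_hom_diff:
  fixes \<phi> :: "'a::comm_ring_1 \<Rightarrow> 'b::comm_ring_1"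
  assumes "\<phi> 0 = 0" "\<And>x y. \<phi> (x - y) = \<phi> x - \<phi> y"
  shows "map_poly \<phi> (p - q) = map_poly \<phi> p - map_poly \<phi> q"
  by (intro poly_eqI) (simp add: coeff_map_poly assms)

text \<open>Division with remainder commutes with extension of the field of coefficients.\<close>

lemma dvd_poly_of_rat_imp_dvd:
  fixes p q :: "rat poly"
  assumes "map_poly of_rat p dvd (map_poly of_rat q :: complex poly)"
  shows "p dvd q"
proof (cases "p = 0")
  case True
  then show ?thesis using assms by (simp add: map_poly_eq_0_iff)
next
  case False
  let ?h = "map_poly (of_rat :: rat \<Rightarrow> complex)"
  have hm: "?h (a * b) = ?h a * ?h b" "?h (a + b) = ?h a + ?h b" for a b
    by (simp_all add: map_poly_hom_mult map_poly_hom_add of_rat_add of_rat_mult)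
  have deg: "degree (?h a) = degree a" for a by (rule degree_map_poly) simp
  have "?h q = ?h (q div p) * ?h p + ?h (q mod p)"
    by (metis hm div_mult_mod_eq)
  then have d: "?h p dvd ?h (q mod p)"
    using assms by (metis dvd_add_right_iff dvd_triv_right)
  have "q mod p = 0"
  proof (rule ccontr)
    assume nz: "q mod p \<noteq> 0"
    then have "?h (q mod p) \<noteq> 0" by (simp add: map_poly_eq_0_iff)
    with d have "degree p \<le> degree (q mod p)" using dvd_imp_degree_le deg by metis
    moreover have "degree (q mod p) < degree p"
      using degree_mod_less'[OF False nz] .
    ultimately show False by simp
  qed
  then show ?thesis by auto
qed

lemma clear_denominators:
  fixes p :: "rat poly"
  shows "\<exists>c a. c \<noteq> 0 \<and> map_poly of_int a = smult (of_int c) p"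
proof (induction p)
  case 0
  show ?case by (rule exI[of _ 1], rule exI[of _ 0]) simp
next
  case (pCons x p)
  then obtain c a where ca: "c \<noteq> 0" "map_poly of_int a = smult (of_int c) p" by blast
  obtain u v where uv: "quotient_of x = (u, v)" by fastforce
  then have v: "v \<noteq> 0" "x = of_int u / of_int v"
    using quotient_of_denom_pos[OF uv] quotient_of_div[OF uv] by auto
  have "map_poly of_int (pCons (c * u) (smult v a)) = smult (of_int (c * v)) (pCons x p)"
    using ca v by (simp add: map_poly_pCons map_poly_smult mult.commute)
  then show ?case using ca(1) v(1) by (metis mult_eq_0_iff)
qed

text \<open>
  The complex roots of \<open>gcd X F\<close> over the rationals are the common roots, so by the Nullstellensatz the
  gcd divides a power of \<open>S\<close>. The Bezout identity for the gcd then only needs its denominators cleared.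
  A power is required because the common roots may be multiple.
\<close>

lemma Bezout_over_int:
  fixes X F S :: "int poly"
  assumes "X \<noteq> 0"
    and roots: "\<And>z::complex. poly (map_poly of_int X) z = 0 \<Longrightarrow> poly (map_poly of_int F) z = 0
      \<Longrightarrow> poly (map_poly of_int S) z = 0"
  shows "\<exists>c m A B. c \<noteq> 0 \<and> smult c (S ^ m) = A * X + B * F"
proof -
  let ?i = "map_poly (of_int :: int \<Rightarrow> rat)" and ?h = "map_poly (of_rat :: rat \<Rightarrow> complex)"
    and ?c = "map_poly (of_int :: int \<Rightarrow> complex)"
  have im: "?i (a * b) = ?i a * ?i b" "?i (a + b) = ?i a + ?i b" for a b
    by (simp_all add: map_poly_hom_mult map_poly_hom_add)
  have hm: "?h (a * b) = ?h a * ?h b" for a b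
    by (simp add: map_poly_hom_mult of_rat_add of_rat_mult)
  have ip: "?i (a ^ m) = ?i a ^ m" for a m
    by (induction m) (simp_all add: im)
  have hp: "?h (a ^ m) = ?h a ^ m" for a m
    by (induction m) (simp_all add: hm)
  have hi: "?h (?i a) = ?c a" for a
    by (intro poly_eqI) (simp add: coeff_map_poly)
  define G where "G = gcd (?i X) (?i F)"
  have nz: "?h G \<noteq> 0" using \<open>X \<noteq> 0\<close> by (simp add: G_def map_poly_eq_0_iff)
  have "poly (?h (?i S)) z = 0" if "poly (?h G) z = 0" for z
  proof -
    have "?h G dvd ?h (?i X)" "?h G dvd ?h (?i F)"
      unfolding G_def by (metis dvd_def hm gcd_dvd1, metis dvd_def hm gcd_dvd2)
    then have "poly (?c X) z = 0" "poly (?c F) z = 0"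
      using that by (auto simp: hi dvd_def)
    then show ?thesis using roots by (simp add: hi)
  qed
  then have "?h G dvd ?h (?i S) ^ degree (?h G)"
    using nullstellensatz_univariate nz by blast
  then have "G dvd ?i S ^ degree (?h G)"
    by (intro dvd_poly_of_rat_imp_dvd) (simp add: hp)
  then obtain m D where D: "?i S ^ m = G * D" by (auto elim: dvdE)
  obtain a b where ab: "a * ?i X + b * ?i F = G"
    using bezout_coefficients_fst_snd unfolding G_def by blast
  obtain ca A where A: "ca \<noteq> 0" "?i A = smult (of_int ca) (D * a)"
    using clear_denominators by blast
  obtain cb B where B: "cb \<noteq> 0" "?i B = smult (of_int cb) (D * b)"
    using clear_denominators by blast
  have ismult: "?i (smult s t) = smult (of_int s) (?i t)" for s t
    by (simp add: map_poly_smult)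
  have "?i (smult (ca * cb) (S ^ m)) = ?i (smult cb A * X + smult ca B * F)"
    unfolding ismult im ip A B D ab[symmetric] by (simp add: algebra_simps smult_add_right)
  then have "smult (ca * cb) (S ^ m) = smult cb A * X + smult ca B * F"
    by (simp only: poly_eq_iff coeff_map_poly of_int_0 of_int_eq_iff simp_thms)
  then show ?thesis using A(1) B(1) by (metis mult_eq_0_iff)
qed

text \<open>
  A root \<open>g\<close> of \<open>F\<close> of exact order \<open>k\<close> modulo \<open>r\<close> is a common root of \<open>F\<close> and \<open>x\<^sup>k - 1\<close>. The
  product \<open>S\<close> of the \<open>x\<^sup>d - 1\<close> with \<open>0 < d < k\<close> absorbs the common complex roots of smaller
  order, and it is invertible modulo \<open>r\<close> at \<open>g\<close>. This avoids cyclotomic polynomials.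
\<close>

lemma no_root_of_exact_order:
  fixes F :: "int poly"
  assumes "k \<ge> 1"
    and F: "\<And>z::complex. z ^ k = 1 \<Longrightarrow> (\<And>d. 0 < d \<Longrightarrow> d < k \<Longrightarrow> z ^ d \<noteq> 1)
      \<Longrightarrow> poly (map_poly of_int F) z \<noteq> 0"
  shows "\<exists>N::int. N \<noteq> 0 \<and> (\<forall>r g. prime r \<longrightarrow> [g ^ k = 1] (mod r) \<longrightarrow>
    (\<forall>d. 0 < d \<longrightarrow> d < k \<longrightarrow> \<not> [g ^ d = 1] (mod r)) \<longrightarrow> r dvd poly F g \<longrightarrow> r dvd N)"
proof -
  let ?c = "map_poly (of_int :: int \<Rightarrow> complex)"
  define X :: "int poly" where "X = monom 1 k - 1"
  define S :: "int poly" where "S = (\<Prod>d\<in>{0<..<k}. monom 1 d - 1)"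
  have cm: "?c (a * b) = ?c a * ?c b" "?c (a - b) = ?c a - ?c b" for a b
    by (simp_all add: map_poly_hom_mult map_poly_hom_diff)
  have c1: "poly (?c (monom 1 d - 1)) z = z ^ d - 1" for d z
    by (simp add: cm map_poly_monom poly_monom)
  have cS: "poly (?c (\<Prod>d\<in>D. monom 1 d - 1)) z = (\<Prod>d\<in>D. z ^ d - 1)" if "finite D" for D z
    using that by (induction D) (simp_all add: cm(1) c1)
  have "poly X 0 \<noteq> 0" using \<open>k \<ge> 1\<close> by (simp add: X_def poly_monom zero_power)
  then have "X \<noteq> 0" by auto
  moreover have "poly (?c S) z = 0"
    if X0: "poly (?c X) z = 0" and F0: "poly (?c F) z = 0" for z
  proof -
    have "z ^ k = 1" using X0 by (simp add: X_def c1)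
    then obtain d where "0 < d" "d < k" "z ^ d = 1" using F F0 by blast
    then show ?thesis unfolding S_def by (subst cS) (auto intro!: bexI[of _ d])
  qed
  ultimately obtain N m A B where N: "N \<noteq> 0" "smult N (S ^ m) = A * X + B * F"
    using Bezout_over_int by blast
  have "r dvd N" if r: "prime r" "[g ^ k = 1] (mod r)" "r dvd poly F g"
    and g: "\<forall>d. 0 < d \<longrightarrow> d < k \<longrightarrow> \<not> [g ^ d = 1] (mod r)" for r g :: int
  proof -
    have "r dvd poly X g"
      using r(2) by (simp add: X_def poly_monom cong_iff_dvd_diff)
    then have "r dvd poly (A * X + B * F) g" using r(3) by simp
    then have "r dvd N * poly S g ^ m" by (simp flip: N(2))
    moreover have "\<not> r dvd poly S g"
      using g r(1) by (auto simp: S_def poly_prod poly_monom prime_dvd_prod_iff cong_iff_dvd_diff)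
    ultimately show ?thesis
      using r(1) by (metis prime_dvd_mult_iff prime_dvd_power)
  qed
  then show ?thesis using N(1) by blast
qed

text \<open>
  The direct similarity about \<open>1\<close> that takes one inscribed triangle to the other takes the unit circle
  to itself, so it is the identity. In algebraic terms: on the unit circle conjugation is
  inversion, and dividing the relation by its conjugate gives \<open>u v' = v u'\<close>.
\<close>

lemma similar_triangles_on_unit_circle:
  fixes u v u' v' :: complex
  assumes "norm u = 1" "norm v = 1" "norm u' = 1" "norm v' = 1"
    and ne: "u \<noteq> 1" "v \<noteq> 1" "u' \<noteq> 1" "v' \<noteq> 1" "u \<noteq> v"
    and eq: "(v - 1) * (u' - 1) = (v' - 1) * (u - 1)"
  shows "u = u'"
proof -
  have cnj_inv: "cnj z * z = 1" if "norm z = 1" for z :: complex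
    using that by (simp add: complex_norm_square[symmetric] mult.commute)
  let ?U = "cnj u" and ?V = "cnj v" and ?U' = "cnj u'" and ?V' = "cnj v'"
  have c: "?U * u = 1" "?V * v = 1" "?U' * u' = 1" "?V' * v' = 1"
    using assms(1-4) cnj_inv by auto
  have conj_eq: "(?V - 1) * (?U' - 1) = (?V' - 1) * (?U - 1)"
    using arg_cong[OF eq, of cnj] by simp
  have "(?V * v - v) * (?U' * u' - u') * (u * v') = ((?V - 1) * (?U' - 1)) * (u * v * u' * v')"
    by (simp add: algebra_simps)
  also have "\<dots> = (?V' * v' - v') * (?U * u - u) * (v * u')"
    unfolding conj_eq by (simp add: algebra_simps)
  finally have "(?V * v - v) * (?U' * u' - u') * (u * v') =
    (?V' * v' - v') * (?U * u - u) * (v * u')" .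
  then have "(1 - v) * (1 - u') * (u * v') = (1 - v') * (1 - u) * (v * u')"
    by (simp only: c)
  then have "(v - 1) * (u' - 1) * (u * v') = (v' - 1) * (u - 1) * (v * u')"
    by (simp add: algebra_simps)
  moreover have "(v' - 1) * (u - 1) \<noteq> 0" using ne by simp
  ultimately have "u * v' = v * u'" unfolding eq by simp
  moreover have "u * ((v - 1) * (u' - 1)) = (u * v' - u) * (u - 1)"
    unfolding eq by (simp add: algebra_simps)
  ultimately have "(u - v) * (u - u') = 0" by (simp add: algebra_simps)
  then show ?thesis using ne by simp
qed

text \<open>
  With \<open>k\<close> fixed there are only finitely many relations to exclude, one for each
  quadruple of exponents; each of them can be a congruence for only finitely many primes.
\<close>

lemma similar_triangles_mod_prime:
  assumes "k \<ge> 1"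
  shows "\<exists>E::nat set. finite E \<and> (\<forall>r g a b c d. prime r \<and> r \<notin> E \<and>
    [g ^ k = 1] (mod int r) \<and> (\<forall>d. 0 < d \<longrightarrow> d < k \<longrightarrow> \<not> [g ^ d = 1] (mod int r)) \<and>
    a \<in> {0<..<k} \<and> b \<in> {0<..<k} \<and> c \<in> {0<..<k} \<and> d \<in> {0<..<k} \<and> a \<noteq> b \<and>
    [(g ^ b - 1) * (g ^ c - 1) = (g ^ d - 1) * (g ^ a - 1)] (mod int r) \<longrightarrow> a = c)"
proof -
  define F :: "nat \<Rightarrow> nat \<Rightarrow> nat \<Rightarrow> nat \<Rightarrow> int poly" where "F a b c d =
    (monom 1 b - 1) * (monom 1 c - 1) - (monom 1 d - 1) * (monom 1 a - 1)" for a b c d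
  define Q where "Q = {(a, b, c, d). a \<in> {0<..<k} \<and> b \<in> {0<..<k} \<and> c \<in> {0<..<k} \<and> d \<in> {0<..<k}
    \<and> a \<noteq> b \<and> a \<noteq> c}"
  let ?c = "map_poly (of_int :: int \<Rightarrow> complex)"
  have cm: "?c (x * y) = ?c x * ?c y" "?c (x - y) = ?c x - ?c y" for x y
    by (simp_all add: map_poly_hom_mult map_poly_hom_diff)
  have "\<exists>N::int. N \<noteq> 0 \<and> (\<forall>r g. prime r \<longrightarrow> [g ^ k = 1] (mod r) \<longrightarrow>
    (\<forall>d. 0 < d \<longrightarrow> d < k \<longrightarrow> \<not> [g ^ d = 1] (mod r)) \<longrightarrow> r dvd poly (F a b c d) g \<longrightarrow> r dvd N)"
    if Q: "(a, b, c, d) \<in> Q" for a b c d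
  proof (rule no_root_of_exact_order[OF assms])
    fix z :: complex
    assume z: "z ^ k = 1" and prim: "\<And>d. 0 < d \<Longrightarrow> d < k \<Longrightarrow> z ^ d \<noteq> 1"
    have "norm z ^ k = 1 ^ k" using z by (simp flip: norm_power)
    then have nz: "norm z = 1"
      using power_eq_iff_eq_base[of k "norm z" 1] assms by simp
    have ne: "z ^ i \<noteq> z ^ j" if "i \<noteq> j" "i < k" "j < k" for i j
    proof -
      have *: "z ^ i \<noteq> z ^ j" if "i < j" "j < k" for i j
      proof
        assume eq: "z ^ i = z ^ j"
        have "z ^ j = z ^ i * z ^ (j - i)" using that by (simp flip: power_add)
        with eq have "z ^ i * z ^ (j - i) = z ^ i" by simp
        moreover have "z \<noteq> 0" using nz by auto
        ultimately show False using prim[of "j - i"] that by simp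
      qed
      from that show ?thesis using *[of i j] *[of j i] by (cases i j rule: linorder_cases) auto
    qed
    show "poly (?c (F a b c d)) z \<noteq> 0"
    proof
      assume "poly (?c (F a b c d)) z = 0"
      then have "(z ^ b - 1) * (z ^ c - 1) = (z ^ d - 1) * (z ^ a - 1)"
        by (simp add: F_def cm map_poly_monom poly_monom)
      moreover have "z ^ a \<noteq> 1" "z ^ b \<noteq> 1" "z ^ c \<noteq> 1" "z ^ d \<noteq> 1" "z ^ a \<noteq> z ^ b"
        using Q prim ne[of a b] by (simp_all add: Q_def)
      moreover have "norm (z ^ i) = 1" for i by (simp add: norm_power nz)
      ultimately have "z ^ a = z ^ c" using similar_triangles_on_unit_circle by blast
      then show False using ne[of a c] Q by (simp add: Q_def)
    qed
  qed
  then obtain N :: "nat \<Rightarrow> nat \<Rightarrow> nat \<Rightarrow> nat \<Rightarrow> int" where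
    N: "\<And>a b c d. (a, b, c, d) \<in> Q \<Longrightarrow> N a b c d \<noteq> 0"
      "\<And>a b c d r g. (a, b, c, d) \<in> Q \<Longrightarrow> prime r \<Longrightarrow> [g ^ k = 1] (mod r) \<Longrightarrow>
    (\<forall>d. 0 < d \<longrightarrow> d < k \<longrightarrow> \<not> [g ^ d = 1] (mod r)) \<Longrightarrow> r dvd poly (F a b c d) g \<Longrightarrow> r dvd N a b c d"
    by metis
  define E :: "nat set" where "E = (\<Union>(a, b, c, d)\<in>Q. {r. int r dvd N a b c d})"
  have "finite Q"
    by (rule finite_subset[of _ "{0<..<k} \<times> {0<..<k} \<times> {0<..<k} \<times> {0<..<k}"]) (auto simp: Q_def)
  moreover have "finite {r. int r dvd N a b c d}" if "(a, b, c, d) \<in> Q" for a b c d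
  proof -
    have "{r. int r dvd N a b c d} \<subseteq> {..nat \<bar>N a b c d\<bar>}"
      using N(1)[OF that] dvd_imp_le_int by force
    then show ?thesis using finite_subset by blast
  qed
  ultimately have "finite E" by (auto simp: E_def)
  have main: "a = c" if h: "prime r" "r \<notin> E" "[g ^ k = 1] (mod int r)"
      "\<forall>d. 0 < d \<longrightarrow> d < k \<longrightarrow> \<not> [g ^ d = 1] (mod int r)"
      "a \<in> {0<..<k}" "b \<in> {0<..<k}" "c \<in> {0<..<k}" "d \<in> {0<..<k}" "a \<noteq> b"
      "[(g ^ b - 1) * (g ^ c - 1) = (g ^ d - 1) * (g ^ a - 1)] (mod int r)" for r g a b c d
  proof (rule ccontr)
    assume "a \<noteq> c"
    with h have Q: "(a, b, c, d) \<in> Q" by (simp add: Q_def)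
    moreover have "int r dvd poly (F a b c d) g"
      using h(10) by (simp add: F_def poly_monom cong_iff_dvd_diff)
    ultimately have "int r dvd N a b c d" using N(2) h(1,3,4) by simp
    then show False using Q h(2) by (auto simp: E_def)
  qed
  show ?thesis
    by (intro exI[of _ E] conjI allI impI, fact, elim conjE, rule main; assumption)
qed

lemma roots_of_unity_mod_prime:
  assumes r: "prime r" and k: "k dvd r - 1"
  obtains g :: int where "[g ^ k = 1] (mod int r)"
    "\<And>d. 0 < d \<Longrightarrow> d < k \<Longrightarrow> \<not> [g ^ d = 1] (mod int r)"
    "\<And>x. [x ^ k = 1] (mod int r) \<Longrightarrow> \<exists>t<k. [x = g ^ t] (mod int r)"
proof -
  have r2: "r \<ge> 2" using r prime_ge_2_nat by blast
  obtain m where m: "r - 1 = m * k" using k by (metis dvd_def mult.commute)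
  have m0: "m > 0" "k > 0" using m r2 by (auto intro!: Nat.gr0I)
  obtain h where h: "residue_primroot r h"
    using prime_primitive_root_exists[OF _ r] r2 by auto
  have "totient r = m * k" by (simp only: totient_prime[OF r] m)
  then have ord: "ord r h = m * k" "coprime r h"
    using h by (auto simp: residue_primroot_def)
  have pw: "[int h ^ e = 1] (mod int r) \<longleftrightarrow> m * k dvd e" for e
    using ord_divides[of h e r] ord by (metis cong_int_iff of_nat_1 of_nat_power)
  show ?thesis
  proof (rule that[of "int h ^ m"])
    show "[(int h ^ m) ^ k = 1] (mod int r)"
      by (simp add: pw flip: power_mult)
    show "\<not> [(int h ^ m) ^ d = 1] (mod int r)" if "0 < d" "d < k" for d
      using that m0 by (auto simp: pw simp flip: power_mult dest: dvd_imp_le)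
    show "\<exists>t<k. [x = (int h ^ m) ^ t] (mod int r)" if x: "[x ^ k = 1] (mod int r)" for x
    proof -
      define y where "y = nat (x mod int r)"
      have y: "[int y = x] (mod int r)" "y < r" using r2 by (auto simp: y_def nat_less_iff)
      have "coprime (x ^ k) (int r)" using cong_imp_coprime[OF cong_sym[OF x]] by simp
      then have "coprime x (int r)" using m0 by simp
      then have "coprime (int y) (int r)" using cong_imp_coprime[OF cong_sym[OF y(1)]] by blast
      then have "coprime y r" by simp
      then have "y \<in> totatives r" using y(2) r2
        by (auto simp: totatives_def intro!: Nat.gr0I)
      then obtain e where e: "[int y = int h ^ e] (mod int r)"
      proof -
        have "y \<in> (\<lambda>i. h ^ i mod r) ` {..<totient r}"
          using residue_primroot_is_generator[OF _ h] \<open>y \<in> totatives r\<close> r2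
          by (simp add: bij_betw_def)
        then obtain e where "[y = h ^ e] (mod r)" by (auto simp: cong_def)
        then show ?thesis using that by (metis cong_int_iff of_nat_power)
      qed
      then have xe: "[x = int h ^ e] (mod int r)" using y cong_sym cong_trans by blast
      then have "[x ^ k = int h ^ (e * k)] (mod int r)" by (metis cong_pow power_mult)
      then have "m * k dvd e * k" using pw x cong_sym cong_trans by blast
      then have "m dvd e" using m0 by simp
      then obtain s where s: "e = m * s" by auto
      have "[e = m * (s mod k)] (mod m * k)"
        unfolding s cong_def mult_mod_right by (rule mod_mod_trivial[symmetric])
      then have "[int h ^ e = int h ^ (m * (s mod k))] (mod int r)"
        using order_divides_expdiff[of r h] ord by (metis cong_int_iff of_nat_power)
      then have "[x = (int h ^ m) ^ (s mod k)] (mod int r)"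
        using xe cong_trans by (metis power_mult)
      then show ?thesis using m0 by (metis mod_less_divisor)
    qed
  qed
qed

lemma cong_multiple:
  fixes R :: int
  assumes "[a = b] (mod R)" "a' - b' = (a - b) * s"
  shows "[a' = b'] (mod R)"
  using assms by (auto simp: cong_iff_dvd_diff)

lemma cong_prime_cancel:
  fixes R :: int
  assumes "prime R" "\<not> R dvd c" "[a * c = b * c] (mod R)"
  shows "[a = b] (mod R)"
  using assms by (auto simp: cong_iff_dvd_diff prime_dvd_mult_iff simp flip: left_diff_distrib)

lemma fermat_inverse:
  assumes "prime r" "\<not> int r dvd x"
  shows "[x ^ (r - 2) * x = 1] (mod int r)"
proof -
  have "coprime x (int r)"
    using assms by (metis coprime_commute prime_imp_coprime prime_nat_int_transfer)
  moreover have "residues (int r)"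
    using prime_gt_1_nat[OF assms(1)] by (simp add: residues_def)
  ultimately have "[x ^ totient r = 1] (mod int r)"
    using residues.euler_theorem by fastforce
  moreover have "totient r = Suc (r - 2)"
    using assms(1) prime_ge_2_nat[of r] by (simp add: totient_prime)
  ultimately show ?thesis by (simp add: mult.commute)
qed

text \<open>
  If \<open>x, y, z\<close> were distinct with equal \<open>M\<close>-th powers, and likewise after adding \<open>1\<close>, then
  \<open>u = y / x\<close>, \<open>v = (1 + y) / (1 + x)\<close>, \<open>u' = z / x\<close>, \<open>v' = (1 + z) / (1 + x)\<close> would be \<open>M\<close>-th
  roots of unity. Since \<open>u - 1 = (y - x) / x\<close> and \<open>v - 1 = (y - x) / (1 + x)\<close>, both
  \<open>(v - 1) (u' - 1)\<close> and \<open>(v' - 1) (u - 1)\<close> equal \<open>(y - x) (z - x) / (x (1 + x))\<close>.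
\<close>

lemma no_three_with_equal_powers:
  assumes "M \<ge> 1"
  shows "\<exists>E::nat set. finite E \<and> (\<forall>r x y z. prime r \<longrightarrow> r \<notin> E \<longrightarrow> M dvd r - 1 \<longrightarrow>
    x \<in> {0<..<int r - 1} \<longrightarrow> y \<in> {0<..<int r - 1} \<longrightarrow> z \<in> {0<..<int r - 1} \<longrightarrow>
    [y ^ M = x ^ M] (mod int r) \<longrightarrow> [z ^ M = x ^ M] (mod int r) \<longrightarrow>
    [(1 + y) ^ M = (1 + x) ^ M] (mod int r) \<longrightarrow> [(1 + z) ^ M = (1 + x) ^ M] (mod int r) \<longrightarrow>
    x = y \<or> x = z \<or> y = z)"
proof -
  obtain E :: "nat set" where "finite E" and E: "\<And>r g a b c d. prime r \<and> r \<notin> E \<and>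
    [g ^ M = 1] (mod int r) \<and> (\<forall>d. 0 < d \<longrightarrow> d < M \<longrightarrow> \<not> [g ^ d = 1] (mod int r)) \<and>
    a \<in> {0<..<M} \<and> b \<in> {0<..<M} \<and> c \<in> {0<..<M} \<and> d \<in> {0<..<M} \<and> a \<noteq> b \<and>
    [(g ^ b - 1) * (g ^ c - 1) = (g ^ d - 1) * (g ^ a - 1)] (mod int r) \<Longrightarrow> a = c"
    using similar_triangles_mod_prime[OF assms] by metis
  have False
    if r: "prime r" "r \<notin> E" "M dvd r - 1"
      and x: "x \<in> {0<..<int r - 1}" and y: "y \<in> {0<..<int r - 1}" and z: "z \<in> {0<..<int r - 1}"
      and eqs: "[y ^ M = x ^ M] (mod int r)" "[z ^ M = x ^ M] (mod int r)"
        "[(1 + y) ^ M = (1 + x) ^ M] (mod int r)" "[(1 + z) ^ M = (1 + x) ^ M] (mod int r)"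
      and ne: "x \<noteq> y" "x \<noteq> z" "y \<noteq> z" for r x y z
  proof -
    obtain g where g: "[g ^ M = 1] (mod int r)"
      "\<And>d. 0 < d \<Longrightarrow> d < M \<Longrightarrow> \<not> [g ^ d = 1] (mod int r)"
      "\<And>x. [x ^ M = 1] (mod int r) \<Longrightarrow> \<exists>t<M. [x = g ^ t] (mod int r)"
      using roots_of_unity_mod_prime[OF r(1,3)] by metis
    have pr: "prime (int r)" using r(1) by simp
    have unit: "\<not> int r dvd w" if "0 < w" "w < int r" for w
      using that by (simp add: zdvd_not_zless)
    have incong: "\<not> [w = w'] (mod int r)" if "w \<noteq> w'" "w \<in> {0<..<int r - 1}" "w' \<in> {0<..<int r - 1}" for w w'
      using that cong_less_imp_eq_int[of w "int r" w'] by auto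
    \<comment> \<open>\<open>s\<close> and \<open>t\<close> are the inverses of \<open>x\<close> and \<open>1 + x\<close>.\<close>
    define s t where "s = x ^ (r - 2)" and "t = (1 + x) ^ (r - 2)"
    have s: "[s * x = 1] (mod int r)" and t: "[t * (1 + x) = 1] (mod int r)"
      unfolding s_def t_def using r(1) x unit by (auto intro!: fermat_inverse)
    have root: "[(s' * w) ^ M = 1] (mod int r)"
      if "[s' * x' = 1] (mod int r)" "[w ^ M = x' ^ M] (mod int r)" for s' x' w :: int
    proof -
      have "[(s' * w) ^ M = s' ^ M * x' ^ M] (mod int r)"
        using that(2) by (simp add: power_mult_distrib cong_mult)
      also have "[s' ^ M * x' ^ M = 1] (mod int r)"
        using cong_pow[OF that(1), of M] by (simp add: power_mult_distrib)
      finally show ?thesis .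
    qed
    have diff: "[s * w - 1 = s * (w - x)] (mod int r)" "[t * (1 + w) - 1 = t * (w - x)] (mod int r)" for w
      by (rule cong_multiple[OF s, of _ _ 1], simp add: algebra_simps)
        (rule cong_multiple[OF t, of _ _ 1], simp add: algebra_simps)
    have ns: "\<not> int r dvd s" "\<not> int r dvd t"
      using s t pr by (auto dest!: cong_dvd_iff simp: prime_dvd_mult_iff)
    have nd: "\<not> int r dvd y - x" "\<not> int r dvd z - x" "\<not> int r dvd z - y"
      using incong ne x y z by (auto simp: cong_iff_dvd_diff)
    obtain a b c d where abcd: "a < M" "b < M" "c < M" "d < M"
      "[s * y = g ^ a] (mod int r)" "[t * (1 + y) = g ^ b] (mod int r)"
      "[s * z = g ^ c] (mod int r)" "[t * (1 + z) = g ^ d] (mod int r)"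
      using g(3) root[OF s] root[OF t] eqs by metis
    have nz: "e \<noteq> 0" if "[s' * w - 1 = s' * u] (mod int r)" "[s' * w = g ^ e] (mod int r)"
      "\<not> int r dvd s'" "\<not> int r dvd u" for s' w u e
    proof
      assume "e = 0"
      then have "int r dvd s' * w - 1" using that(2) by (simp add: cong_iff_dvd_diff)
      then have "int r dvd s' * u" using that(1) by (simp add: cong_dvd_iff)
      then show False using that(3,4) pr by (simp add: prime_dvd_mult_iff)
    qed
    have pos: "a \<noteq> 0" "b \<noteq> 0" "c \<noteq> 0" "d \<noteq> 0"
      using nz diff abcd(5-8) ns nd by blast+
    have "a \<noteq> b"
    proof
      assume "a = b"
      then have "[s * y = t * (1 + y)] (mod int r)"
        using abcd(5,6) by (metis cong_sym cong_trans)
      then have "[s * y * (x * (1 + x)) = t * (1 + y) * (x * (1 + x))] (mod int r)"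
        by (rule cong_scalar_right)
      moreover have "[s * y * (x * (1 + x)) = y * (1 + x)] (mod int r)"
        by (rule cong_multiple[OF s, of _ _ "y * (1 + x)"]) (simp add: algebra_simps)
      moreover have "[t * (1 + y) * (x * (1 + x)) = x * (1 + y)] (mod int r)"
        by (rule cong_multiple[OF t, of _ _ "x * (1 + y)"]) (simp add: algebra_simps)
      ultimately have "[y * (1 + x) = x * (1 + y)] (mod int r)"
        by (metis cong_sym cong_trans)
      then have "[y = x] (mod int r)" by (rule cong_multiple[of _ _ _ _ _ 1]) (simp add: algebra_simps)
      then show False using nd by (simp add: cong_iff_dvd_diff)
    qed
    have gd: "[g ^ a - 1 = s * (y - x)] (mod int r)" "[g ^ b - 1 = t * (y - x)] (mod int r)"
      "[g ^ c - 1 = s * (z - x)] (mod int r)" "[g ^ d - 1 = t * (z - x)] (mod int r)"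
      using diff abcd(5-8) by (meson cong_diff cong_refl cong_sym cong_trans)+
    have "[(g ^ b - 1) * (g ^ c - 1) = (t * (y - x)) * (s * (z - x))] (mod int r)"
      using gd by (intro cong_mult)
    also have "(t * (y - x)) * (s * (z - x)) = (t * (z - x)) * (s * (y - x))" by simp
    also have "[\<dots> = (g ^ d - 1) * (g ^ a - 1)] (mod int r)"
      using gd by (intro cong_mult) (auto simp: cong_sym)
    finally have "a = c"
      using E[of r g a b c d] r g pos abcd \<open>a \<noteq> b\<close> by simp
    then have "[s * y = s * z] (mod int r)"
      using abcd by (metis cong_sym cong_trans)
    then have "[z * s = y * s] (mod int r)" by (simp add: mult.commute cong_sym)
    then have "[z = y] (mod int r)" using cong_prime_cancel pr ns(1) by blast
    then show False using nd by (simp add: cong_iff_dvd_diff)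
  qed
  then show ?thesis using \<open>finite E\<close> by (intro exI[of _ E]) blast
qed

section \<open>Counting fibres with at most two elements\<close>

text \<open>
  A fibre of size two contributes two to the domain and two ordered pairs of distinct elements with
  the same value; a fibre of size one contributes one and none.
\<close>

lemma fibre_counts:
  fixes f :: "'a \<Rightarrow> 'b"
  assumes S: "finite S" and I: "finite I" "f ` S \<subseteq> I"
    and le2: "\<And>c. c \<in> I \<Longrightarrow> card {x\<in>S. f x = c} \<le> 2"
  shows "card {c\<in>I. card {x\<in>S. f x = c} = 1} + 2 * card {c\<in>I. card {x\<in>S. f x = c} = 2} = card S"
    and "2 * card {c\<in>I. card {x\<in>S. f x = c} = 2} =
      card {(x, y). x \<in> S \<and> y \<in> S \<and> x \<noteq> y \<and> f x = f y}"
proof -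
  define t where "t c = card {x\<in>S. f x = c}" for c
  have t2: "t c = 0 \<or> t c = 1 \<or> t c = 2" if "c \<in> I" for c
    using le2[OF that] by (auto simp: t_def)
  have cnt: "card {c\<in>I. P c} = (\<Sum>c\<in>I. of_bool (P c))" for P
    using I(1) by (simp add: Int_def conj_commute)
  have "card S = (\<Sum>c\<in>I. \<Sum>x\<in>{x\<in>S. f x = c}. 1)"
    by (subst sum.group) (use S I in auto)
  also have "\<dots> = (\<Sum>c\<in>I. of_bool (t c = 1) + 2 * of_bool (t c = 2))"
    by (intro sum.cong) (use t2 in \<open>force simp: t_def\<close>)+
  also have "\<dots> = card {c\<in>I. t c = 1} + 2 * card {c\<in>I. t c = 2}"
    unfolding cnt by (simp add: sum.distrib sum_distrib_left)
  finally show "card {c\<in>I. card {x\<in>S. f x = c} = 1} + 2 * card {c\<in>I. card {x\<in>S. f x = c} = 2} = card S"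
    by (simp add: t_def)
  have "{(x, y). x \<in> S \<and> y \<in> S \<and> x \<noteq> y \<and> f x = f y} = (SIGMA x:S. {y\<in>S. f y = f x} - {x})"
    by auto
  then have "card {(x, y). x \<in> S \<and> y \<in> S \<and> x \<noteq> y \<and> f x = f y} = (\<Sum>x\<in>S. t (f x) - 1)"
    using S by (simp add: t_def card_Diff_subset)
  also have "\<dots> = (\<Sum>c\<in>I. \<Sum>x\<in>{x\<in>S. f x = c}. t (f x) - 1)"
    by (subst sum.group) (use S I in auto)
  also have "\<dots> = (\<Sum>c\<in>I. 2 * of_bool (t c = 2))"
  proof (intro sum.cong refl)
    fix c assume c: "c \<in> I"
    have "(\<Sum>x\<in>{x\<in>S. f x = c}. t (f x) - 1) = t c * (t c - 1)" by (simp add: t_def)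
    then show "(\<Sum>x\<in>{x\<in>S. f x = c}. t (f x) - 1) = 2 * of_bool (t c = 2)"
      using t2[OF c] by auto
  qed
  also have "\<dots> = 2 * card {c\<in>I. t c = 2}"
    unfolding cnt by (simp add: sum_distrib_left)
  finally show "2 * card {c\<in>I. card {x\<in>S. f x = c} = 2} =
      card {(x, y). x \<in> S \<and> y \<in> S \<and> x \<noteq> y \<and> f x = f y}"
    by (simp add: t_def)
qed

section \<open>Cosets and cells\<close>

locale period_setting =
  fixes n k r q :: nat and K :: "int set"
  assumes n: "n > 1" and k: "k \<ge> 1" and r_eq: "r = n * k + 1" and r: "prime r"
    and q: "\<not> r dvd q" and K: "subgroup K (Zmod_units r)" "card K = k"
    and gen: "generate (Zmod_units r) (insert (residue_class r q) K) = carrier (Zmod_units r)"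
begin

abbreviation U :: "int set" where "U \<equiv> {0<..<int r}"

abbreviation eqr :: "int \<Rightarrow> int \<Rightarrow> bool" (infix "\<equiv>\<^sub>r" 50) where "x \<equiv>\<^sub>r y \<equiv> [x = y] (mod int r)"

lemma r3: "r \<ge> 3"
proof -
  have "n * 1 \<le> n * k" using k by (intro mult_le_mono) auto
  then show ?thesis using n r_eq by linarith
qed

lemma pr: "prime (int r)" using r by simp

lemma k_dvd: "k dvd r - 1" by (simp add: r_eq)

sublocale R: residues_prime r "Zmod r"
  by (rule residues_prime.intro) (rule r)

sublocale G: comm_group "Zmod_units r"
  by (rule R.units_comm_group)

lemma carrier_units: "carrier (Zmod_units r) = U"
  unfolding units_of_carrier R.res_prime_units_eq by auto

lemma mult_units: "x \<otimes>\<^bsub>Zmod_units r\<^esub> y = (x * y) mod int r"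
  by (simp add: units_of_mult R.res_mult_eq)

lemma one_units: "\<one>\<^bsub>Zmod_units r\<^esub> = 1"
  by (simp add: units_of_one R.res_one_eq)

lemma pow_units: "x [^]\<^bsub>Zmod_units r\<^esub> (i::nat) = x ^ i mod int r"
proof (induction i)
  case 0
  then show ?case using r3 by (simp add: one_units)
next
  case (Suc i)
  have "x [^]\<^bsub>Zmod_units r\<^esub> Suc i = (x ^ i mod int r * x) mod int r"
    by (simp only: nat_pow_Suc mult_units Suc)
  also have "\<dots> = x ^ Suc i mod int r"
    by (simp only: mod_mult_left_eq power_Suc2)
  finally show ?case .
qed

lemma U_unit: "x \<in> U \<Longrightarrow> \<not> int r dvd x"
  by (simp add: zdvd_not_zless)

lemma U_eqI: "x \<in> U \<Longrightarrow> y \<in> U \<Longrightarrow> x \<equiv>\<^sub>r y \<Longrightarrow> x = y"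
  using cong_less_imp_eq_int[of x "int r" y] by auto

lemma mod_in_U: "\<not> int r dvd x \<Longrightarrow> x mod int r \<in> U"
  using r3 pos_mod_bound[of "int r" x] pos_mod_sign[of "int r" x]
  by (simp add: dvd_eq_mod_eq_0 order.strict_iff_order)

lemma eqr_unit: "x \<equiv>\<^sub>r y \<Longrightarrow> int r dvd x \<longleftrightarrow> int r dvd y"
  by (rule cong_dvd_iff)

lemma K_sub: "K \<subseteq> U" using subgroup.subset[OF K(1)] by (simp add: carrier_units)

text \<open>By Lagrange's theorem \<open>K\<close> consists of \<open>k\<close>-th roots of unity, and there are at most \<open>k\<close> of these.\<close>

lemma K_eq: "K = {x\<in>U. x ^ k \<equiv>\<^sub>r 1}"
proof (rule card_subset_eq)
  show fin: "finite {x\<in>U. x ^ k \<equiv>\<^sub>r 1}" by (rule finite_subset[of _ U]) auto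
  obtain g :: int where g: "\<And>x. x ^ k \<equiv>\<^sub>r 1 \<Longrightarrow> \<exists>t<k. x \<equiv>\<^sub>r g ^ t"
    using roots_of_unity_mod_prime[OF r k_dvd] by metis
  have "{x\<in>U. x ^ k \<equiv>\<^sub>r 1} \<subseteq> (\<lambda>t. g ^ t mod int r) ` {..<k}"
  proof
    fix x assume x: "x \<in> {x\<in>U. x ^ k \<equiv>\<^sub>r 1}"
    then obtain t where "t < k" "x \<equiv>\<^sub>r g ^ t" using g by blast
    then show "x \<in> (\<lambda>t. g ^ t mod int r) ` {..<k}" using x by (auto simp: cong_def)
  qed
  then have le: "card {x\<in>U. x ^ k \<equiv>\<^sub>r 1} \<le> k"
    using surj_card_le[of "{..<k}"] by simp
  show "K \<subseteq> {x\<in>U. x ^ k \<equiv>\<^sub>r 1}"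
  proof (rule subsetI)
    fix x assume x: "x \<in> K"
    let ?H = "Zmod_units r\<lparr>carrier := K\<rparr>"
    interpret H: group ?H by (rule subgroup.subgroup_is_group[OF K(1) G.is_group])
    have "x [^]\<^bsub>?H\<^esub> Coset.order ?H = \<one>\<^bsub>?H\<^esub>"
      using x by (intro H.pow_order_eq_1) simp
    then have "x [^]\<^bsub>Zmod_units r\<^esub> k = 1"
      using K(2) by (simp add: Coset.order_def one_units nat_pow_def)
    then have "x ^ k \<equiv>\<^sub>r 1" using r3 by (simp add: pow_units cong_def)
    then show "x \<in> {x\<in>U. x ^ k \<equiv>\<^sub>r 1}" using x K_sub by auto
  qed
  then have "k \<le> card {x\<in>U. x ^ k \<equiv>\<^sub>r 1}" using card_mono[OF fin, of K] K(2) by simp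
  with le show "card K = card {x\<in>U. x ^ k \<equiv>\<^sub>r 1}" using K(2) by simp
qed

abbreviation Q :: int where "Q \<equiv> int q"

lemma Q_unit: "\<not> int r dvd Q ^ i"
  using q pr by (metis int_dvd_int_iff prime_dvd_power)

lemma fermat:
  assumes "\<not> int r dvd x"
  shows "x ^ (n * k) \<equiv>\<^sub>r 1"
proof -
  have "n * k = Suc (r - 2)" using r_eq r3 by linarith
  then show ?thesis using fermat_inverse[OF r assms] by (simp add: mult.commute)
qed

lemma coset_eq: "coset_q r q K i = {x\<in>U. x ^ k \<equiv>\<^sub>r Q ^ (i * k)}"
proof -
  have c: "coset_q r q K i = (\<lambda>w. (Q ^ i * w) mod int r) ` K"
    by (auto simp: coset_q_def l_coset_def mult_units pow_units residue_class_def power_mod mod_mult_left_eq)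
  show ?thesis unfolding c
  proof (intro equalityI subsetI)
    fix x assume "x \<in> (\<lambda>w. (Q ^ i * w) mod int r) ` K"
    then obtain w where w: "w \<in> U" "w ^ k \<equiv>\<^sub>r 1" "x = (Q ^ i * w) mod int r" using K_eq by auto
    have "\<not> int r dvd Q ^ i * w" using Q_unit U_unit w(1) pr by (simp add: prime_dvd_mult_iff)
    moreover have "(Q ^ i * w) ^ k \<equiv>\<^sub>r Q ^ (i * k)"
      using cong_scalar_left[OF w(2), of "Q ^ (i * k)"] by (simp add: power_mult_distrib power_mult)
    ultimately show "x \<in> {x\<in>U. x ^ k \<equiv>\<^sub>r Q ^ (i * k)}"
      using w(3) mod_in_U by (auto simp: cong_def power_mod)
  next
    fix x assume x: "x \<in> {x\<in>U. x ^ k \<equiv>\<^sub>r Q ^ (i * k)}"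
    define s where "s = (Q ^ i) ^ (r - 2)"
    have s: "s * Q ^ i \<equiv>\<^sub>r 1" unfolding s_def by (rule fermat_inverse[OF r Q_unit])
    have "(s * x) ^ k \<equiv>\<^sub>r s ^ k * Q ^ (i * k)"
      using x by (simp add: power_mult_distrib cong_scalar_left)
    also have "s ^ k * Q ^ (i * k) \<equiv>\<^sub>r 1"
      using cong_pow[OF s, of k] by (simp add: power_mult_distrib power_mult)
    finally have "(s * x) ^ k \<equiv>\<^sub>r 1" .
    moreover have x': "Q ^ i * (s * x) \<equiv>\<^sub>r x"
      using cong_scalar_right[OF s, of x] by (simp add: ac_simps)
    moreover have "\<not> int r dvd s * x" using eqr_unit[OF x'] x U_unit by (auto intro: dvd_mult)
    ultimately have "(s * x) mod int r \<in> K" using mod_in_U by (simp add: K_eq cong_def power_mod)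
    moreover have "x = (Q ^ i * ((s * x) mod int r)) mod int r"
      using x x' by (simp add: mod_mult_right_eq cong_def)
    ultimately show "x \<in> (\<lambda>w. (Q ^ i * w) mod int r) ` K" by blast
  qed
qed

text \<open>The units whose \<open>k\<close>-th power is a power of \<open>q\<^sup>k\<close> form a subgroup containing \<open>q\<close> and \<open>K\<close>.\<close>

lemma powers_cover: "x \<in> U \<Longrightarrow> \<exists>i. x ^ k \<equiv>\<^sub>r Q ^ (i * k)"
proof -
  have base: "h \<in> U \<and> (\<exists>i. h ^ k \<equiv>\<^sub>r Q ^ (i * k))" if "h \<in> insert (residue_class r q) K" for h
    using that
  proof
    assume h: "h = residue_class r q"
    have "h ^ k \<equiv>\<^sub>r Q ^ (1 * k)" by (simp add: h residue_class_def cong_def power_mod)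
    moreover have "h \<in> U" using Q_unit[of 1] h mod_in_U by (simp add: residue_class_def)
    ultimately show ?thesis by blast
  next
    assume "h \<in> K"
    then have "h \<in> U" "h ^ k \<equiv>\<^sub>r Q ^ (0 * k)" using K_eq by auto
    then show ?thesis by blast
  qed
  have closed: "h1 \<otimes>\<^bsub>Zmod_units r\<^esub> h2 \<in> U \<and> (\<exists>i. (h1 \<otimes>\<^bsub>Zmod_units r\<^esub> h2) ^ k \<equiv>\<^sub>r Q ^ (i * k))"
    if "h1 \<in> U" "h2 \<in> U" "h1 ^ k \<equiv>\<^sub>r Q ^ (i1 * k)" "h2 ^ k \<equiv>\<^sub>r Q ^ (i2 * k)" for h1 h2 i1 i2
  proof -
    have "(h1 * h2) ^ k \<equiv>\<^sub>r Q ^ ((i1 + i2) * k)"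
      using cong_mult[OF that(3,4)] by (simp add: power_mult_distrib add_mult_distrib power_add)
    then have "(h1 \<otimes>\<^bsub>Zmod_units r\<^esub> h2) ^ k \<equiv>\<^sub>r Q ^ ((i1 + i2) * k)"
      by (simp add: mult_units cong_def power_mod)
    moreover have "h1 \<otimes>\<^bsub>Zmod_units r\<^esub> h2 \<in> U"
      using G.m_closed that(1,2) by (simp only: carrier_units)
    ultimately show ?thesis by blast
  qed
  have "x \<in> U \<and> (\<exists>i. x ^ k \<equiv>\<^sub>r Q ^ (i * k))"
    if "x \<in> generate (Zmod_units r) (insert (residue_class r q) K)" for x
    using that
  proof (induction rule: generate.induct)
    case one
    have "(1::int) ^ k \<equiv>\<^sub>r Q ^ (0 * k)" by simp
    then show ?case unfolding one_units using r3 by (intro conjI exI[of _ 0]) auto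
  next
    case (incl h)
    then show ?case using base by blast
  next
    case (inv h)
    define s where "s = inv\<^bsub>Zmod_units r\<^esub> h"
    obtain i where h: "h \<in> U" "h ^ k \<equiv>\<^sub>r Q ^ (i * k)" using base[OF inv] by blast
    have s: "s \<in> U" "(s * h) mod int r = 1"
      using G.inv_closed[of h] G.l_inv[of h] h(1)
      by (simp_all only: carrier_units s_def mult_units one_units)
    then have "s * h \<equiv>\<^sub>r 1" using r3 by (simp add: cong_def)
    then have sh: "s ^ k * h ^ k \<equiv>\<^sub>r 1" using cong_pow[of "s * h" 1 "int r" k] by (simp add: power_mult_distrib)
    have "Q ^ (i * (r - 2) * k) * Q ^ (i * k) \<equiv>\<^sub>r 1"
      using fermat_inverse[OF r Q_unit[of "i * k"]] by (simp flip: power_mult add: ac_simps)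
    then have "Q ^ (i * (r - 2) * k) * h ^ k \<equiv>\<^sub>r 1"
      using cong_scalar_left[OF h(2)] cong_trans by blast
    then have "s ^ k * h ^ k \<equiv>\<^sub>r Q ^ (i * (r - 2) * k) * h ^ k" using sh cong_sym cong_trans by blast
    moreover have "\<not> int r dvd h ^ k" using U_unit[OF h(1)] pr prime_dvd_power by blast
    ultimately have "s ^ k \<equiv>\<^sub>r Q ^ (i * (r - 2) * k)" using cong_prime_cancel pr by blast
    then show ?case using s(1) unfolding s_def by blast
  next
    case (eng h1 h2)
    then show ?case using closed by blast
  qed
  then show "x \<in> U \<Longrightarrow> \<exists>i. x ^ k \<equiv>\<^sub>r Q ^ (i * k)"
    using gen by (simp add: carrier_units)
qed

lemma Q_power_mod: "Q ^ (i * k) \<equiv>\<^sub>r Q ^ ((i mod n) * k)"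
proof -
  have "i * k = n * k * (i div n) + (i mod n) * k"
    by (metis add_mult_distrib mult.assoc mult.commute div_mult_mod_eq)
  then have "Q ^ (i * k) = (Q ^ (n * k)) ^ (i div n) * Q ^ ((i mod n) * k)"
    by (simp only: power_add power_mult)
  also have "\<dots> \<equiv>\<^sub>r 1 ^ (i div n) * Q ^ ((i mod n) * k)"
    using fermat[OF Q_unit[of 1]] by (intro cong_mult cong_pow) auto
  finally show ?thesis by simp
qed

text \<open>
  If the \<open>q\<^sup>i K\<close> repeated with a period \<open>d < n\<close>, then by \<open>powers_cover\<close> the exponent of the unit
  group would divide \<open>d k < r - 1\<close>, contradicting the existence of a primitive root.
\<close>

lemma Q_power_inj:
  assumes "i < n" "j < n" "Q ^ (i * k) \<equiv>\<^sub>r Q ^ (j * k)"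
  shows "i = j"
proof -
  have False if ij: "i < j" "j < n" and eq: "Q ^ (i * k) \<equiv>\<^sub>r Q ^ (j * k)" for i j
  proof -
    define d where "d = j - i"
    have d: "0 < d" "d < n" "j * k = d * k + i * k" using ij
      by (auto simp: d_def simp flip: add_mult_distrib)
    have "1 * Q ^ (i * k) \<equiv>\<^sub>r Q ^ (d * k) * Q ^ (i * k)"
      using eq by (simp add: d(3) power_add)
    then have Qd: "1 \<equiv>\<^sub>r Q ^ (d * k)" using cong_prime_cancel[OF pr Q_unit] by blast
    have pw: "x ^ (d * k) \<equiv>\<^sub>r 1" if "x \<in> U" for x
    proof -
      obtain l where "x ^ k \<equiv>\<^sub>r Q ^ (l * k)" using powers_cover \<open>x \<in> U\<close> by blast
      then have "(x ^ k) ^ d \<equiv>\<^sub>r (Q ^ (l * k)) ^ d" by (rule cong_pow)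
      also have "(Q ^ (l * k)) ^ d = (Q ^ (d * k)) ^ l" by (simp flip: power_mult add: ac_simps)
      also have "\<dots> \<equiv>\<^sub>r 1 ^ l" using Qd by (intro cong_pow) (rule cong_sym)
      finally show ?thesis by (simp flip: power_mult add: ac_simps)
    qed
    obtain g :: int where g: "g ^ (r - 1) \<equiv>\<^sub>r 1" "\<And>d. 0 < d \<Longrightarrow> d < r - 1 \<Longrightarrow> \<not> g ^ d \<equiv>\<^sub>r 1"
      using roots_of_unity_mod_prime[OF r dvd_refl] by metis
    have "\<not> int r dvd g"
    proof
      assume "int r dvd g"
      then have "int r dvd g ^ (r - 1)" using r3 by (intro dvd_trans[OF _ dvd_power]) auto
      then have "int r dvd 1" using eqr_unit[OF g(1)] by simp
      then show False using r3 by simp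
    qed
    then have "g ^ (d * k) \<equiv>\<^sub>r 1"
      using pw[OF mod_in_U, of g] by (simp add: cong_def power_mod)
    moreover have "0 < d * k" "d * k < r - 1" using d k by (auto simp: r_eq)
    ultimately show False using g(2) by blast
  qed
  from this[of i j] this[of j i] assms show ?thesis
    by (cases i j rule: linorder_cases) (auto simp: cong_sym)
qed

text \<open>The index of the coset of \<open>K\<close> that contains \<open>x\<close>.\<close>

definition idx :: "int \<Rightarrow> nat" where
  "idx x = (THE i. i < n \<and> x ^ k \<equiv>\<^sub>r Q ^ (i * k))"

lemma idx_eq_iff: "x \<in> U \<Longrightarrow> i < n \<Longrightarrow> idx x = i \<longleftrightarrow> x ^ k \<equiv>\<^sub>r Q ^ (i * k)"
  and idx_less: "x \<in> U \<Longrightarrow> idx x < n"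
  and idx_power: "x \<in> U \<Longrightarrow> x ^ k \<equiv>\<^sub>r Q ^ (idx x * k)"
proof -
  have ex: "\<exists>!i. i < n \<and> x ^ k \<equiv>\<^sub>r Q ^ (i * k)" if x: "x \<in> U" for x
  proof -
    obtain i where "x ^ k \<equiv>\<^sub>r Q ^ (i * k)" using powers_cover[OF x] by blast
    then have "x ^ k \<equiv>\<^sub>r Q ^ ((i mod n) * k)" using Q_power_mod cong_trans by blast
    moreover have "i mod n < n" using n by simp
    ultimately show ?thesis using Q_power_inj by (metis cong_sym cong_trans)
  qed
  show *: "x \<in> U \<Longrightarrow> idx x < n" "x \<in> U \<Longrightarrow> x ^ k \<equiv>\<^sub>r Q ^ (idx x * k)" for x
    using theI'[OF ex, of x] by (simp_all add: idx_def)
  then show "x \<in> U \<Longrightarrow> i < n \<Longrightarrow> idx x = i \<longleftrightarrow> x ^ k \<equiv>\<^sub>r Q ^ (i * k)"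
    using ex by blast
qed

lemma idx_eq_idx_iff: "x \<in> U \<Longrightarrow> y \<in> U \<Longrightarrow> idx x = idx y \<longleftrightarrow> y ^ k \<equiv>\<^sub>r x ^ k"
  using idx_eq_iff[of y "idx x"] idx_less[of x] idx_power[of x]
  by (metis cong_sym cong_trans)

text \<open>The representatives of the \<open>x\<close> for which both \<open>x\<close> and \<open>1 + x\<close> are units; \<open>-1\<close> is \<open>r - 1\<close>.\<close>

definition S :: "int set" where "S = {0<..<int r - 1}"

lemma S_U: "x \<in> S \<Longrightarrow> x \<in> U" "x \<in> S \<Longrightarrow> 1 + x \<in> U"
  by (auto simp: S_def)

lemma finite_S: "finite S" by (simp add: S_def)

lemma card_S: "card S = n * k - 1" 
proof -
  have "S = {0<..<int (n * k)}" by (simp add: S_def) (simp add: r_eq)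
  then show ?thesis by (simp del: of_nat_mult)
qed

definition cell :: "int \<Rightarrow> nat \<times> nat" where "cell x = (idx x, idx (1 + x))"

lemma cell_in: "cell ` S \<subseteq> {..<n} \<times> {..<n}"
  using S_U idx_less by (auto simp: cell_def)

lemma cyclotomic_number_eq:
  assumes "i < n" "j < n"
  shows "cyclotomic_number r q K i j = card {x\<in>S. cell x = (i, j)}"
proof -
  have "(\<one>\<^bsub>Zmod r\<^esub> <+\<^bsub>Zmod r\<^esub> coset_q r q K i) = (\<lambda>y. (1 + y) mod int r) ` coset_q r q K i"
    by (auto simp: a_l_coset_def' R.res_add_eq R.res_one_eq)
  then have "(\<one>\<^bsub>Zmod r\<^esub> <+\<^bsub>Zmod r\<^esub> coset_q r q K i) \<inter> coset_q r q K j
    = (\<lambda>x. 1 + x) ` {x\<in>S. cell x = (i, j)}"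
  proof (intro equalityI subsetI)
    fix y assume "y \<in> (\<one>\<^bsub>Zmod r\<^esub> <+\<^bsub>Zmod r\<^esub> coset_q r q K i) \<inter> coset_q r q K j"
    then obtain x where x: "x \<in> coset_q r q K i" "y = (1 + x) mod int r" and y: "y \<in> coset_q r q K j"
      using \<open>(\<one>\<^bsub>Zmod r\<^esub> <+\<^bsub>Zmod r\<^esub> coset_q r q K i) = _\<close> by auto
    have xU: "x \<in> U" and "y \<noteq> 0" using x(1) y by (auto simp: coset_eq)
    have "x \<noteq> int r - 1" using \<open>y \<noteq> 0\<close> x(2) by auto
    with xU have xS: "x \<in> S" by (auto simp: S_def)
    then have "y = 1 + x" using x(2) by (simp add: S_def)
    then show "y \<in> (\<lambda>x. 1 + x) ` {x\<in>S. cell x = (i, j)}"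
      using xS x(1) y assms S_U[OF xS] by (auto simp: coset_eq cell_def idx_eq_iff)
  next
    fix y assume "y \<in> (\<lambda>x. 1 + x) ` {x\<in>S. cell x = (i, j)}"
    then obtain x where x: "x \<in> S" "cell x = (i, j)" "y = 1 + x" by blast
    then have "x \<in> coset_q r q K i" "y \<in> coset_q r q K j" "y = (1 + x) mod int r"
      using assms S_U[OF x(1)] by (auto simp: coset_eq cell_def idx_eq_iff)
    then show "y \<in> (\<one>\<^bsub>Zmod r\<^esub> <+\<^bsub>Zmod r\<^esub> coset_q r q K i) \<inter> coset_q r q K j"
      using \<open>(\<one>\<^bsub>Zmod r\<^esub> <+\<^bsub>Zmod r\<^esub> coset_q r q K i) = _\<close> by auto
  qed
  then show ?thesis by (simp add: cyclotomic_number_def card_image)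
qed

end

section \<open>The number of coincidences between cells\<close>

lemma card_le_2I:
  assumes "finite A" "\<And>x y z. x \<in> A \<Longrightarrow> y \<in> A \<Longrightarrow> z \<in> A \<Longrightarrow> x = y \<or> x = z \<or> y = z"
  shows "card A \<le> 2"
proof (rule ccontr)
  assume "\<not> card A \<le> 2"
  then obtain T where T: "T \<subseteq> A" "card T = 3"
    using obtain_subset_with_card_n[of 3 A] by force
  then obtain x y z where "T = {x, y, z}" "x \<noteq> y" "y \<noteq> z" "x \<noteq> z" by (auto simp: card_3_iff)
  then show False using assms(2)[of x y z] T(1) by auto
qed

lemma card_off_diagonal:
  assumes "finite A"
  shows "card {(u, v). u \<in> A \<and> v \<in> A \<and> u \<noteq> v} = card A * (card A - 1)"
proof -
  have "{(u, v). u \<in> A \<and> v \<in> A \<and> u \<noteq> v} = (SIGMA u:A. A - {u})" by auto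
  then show ?thesis using assms by simp
qed

context period_setting
begin

lemma cell_eq_iff:
  "x \<in> S \<Longrightarrow> y \<in> S \<Longrightarrow> cell x = cell y \<longleftrightarrow> y ^ k \<equiv>\<^sub>r x ^ k \<and> (1 + y) ^ k \<equiv>\<^sub>r (1 + x) ^ k"
  using S_U by (simp add: cell_def idx_eq_idx_iff)

lemma S_units: "x \<in> S \<Longrightarrow> \<not> int r dvd x" "x \<in> S \<Longrightarrow> \<not> int r dvd 1 + x"
  using S_U U_unit by blast+

lemma S_eqI: "x \<in> S \<Longrightarrow> y \<in> S \<Longrightarrow> x \<equiv>\<^sub>r y \<Longrightarrow> x = y"
  using S_U U_eqI by blast

lemma mod_in_S:
  assumes "\<not> int r dvd x" "\<not> int r dvd 1 + x"
  shows "x mod int r \<in> S"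
proof -
  have "x mod int r \<noteq> int r - 1"
  proof
    assume "x mod int r = int r - 1"
    then have "(1 + x) mod int r = 0" by (metis add.commute diff_add_cancel mod_add_left_eq mod_self)
    then show False using assms(2) by (simp add: dvd_eq_mod_eq_0)
  qed
  then show ?thesis using mod_in_U[OF assms(1)] by (auto simp: S_def)
qed

lemma ratio_in_K:
  assumes "\<not> int r dvd x" "\<not> int r dvd y" "y ^ k \<equiv>\<^sub>r x ^ k"
  shows "\<exists>u\<in>K. y \<equiv>\<^sub>r u * x"
proof -
  define s where "s = x ^ (r - 2)"
  have s: "s * x \<equiv>\<^sub>r 1" unfolding s_def by (rule fermat_inverse[OF r assms(1)])
  have "(s * y) ^ k \<equiv>\<^sub>r s ^ k * x ^ k" using assms(3) by (simp add: power_mult_distrib cong_scalar_left)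
  also have "s ^ k * x ^ k \<equiv>\<^sub>r 1" using cong_pow[OF s, of k] by (simp add: power_mult_distrib)
  finally have sk: "(s * y) ^ k \<equiv>\<^sub>r 1" .
  have sxy: "(s * y) * x \<equiv>\<^sub>r y" using cong_scalar_right[OF s, of y] by (simp add: ac_simps)
  then have "\<not> int r dvd s * y" using assms(2) eqr_unit[OF sxy] by (auto intro: dvd_mult2)
  then have "(s * y) mod int r \<in> K" using sk mod_in_U by (simp add: K_eq cong_def power_mod)
  moreover have "y \<equiv>\<^sub>r ((s * y) mod int r) * x"
    using sxy by (simp add: cong_def mod_mult_left_eq)
  ultimately show ?thesis by blast
qed

lemma pow_eq_of_ratio: "u \<in> K \<Longrightarrow> y \<equiv>\<^sub>r u * x \<Longrightarrow> y ^ k \<equiv>\<^sub>r x ^ k"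
proof -
  assume u: "u \<in> K" and "y \<equiv>\<^sub>r u * x"
  then have "y ^ k \<equiv>\<^sub>r u ^ k * x ^ k" by (metis cong_pow power_mult_distrib)
  also have "u ^ k * x ^ k \<equiv>\<^sub>r 1 * x ^ k" using u by (intro cong_scalar_right) (simp add: K_eq)
  finally show ?thesis by simp
qed

lemma one_in_K: "1 \<in> K" using r3 by (simp add: K_eq)

lemma finite_K: "finite K" using K_sub finite_subset by blast

lemma card_K_minus_1: "card (K - {1}) = k - 1"
  using K(2) one_in_K finite_K by simp

definition pairs :: "(int \<times> int) set" where
  "pairs = {(x, y). x \<in> S \<and> y \<in> S \<and> x \<noteq> y \<and> cell x = cell y}"

definition ratios :: "int \<times> int \<Rightarrow> int \<times> int \<Rightarrow> bool" where
  "ratios p w \<longleftrightarrow> (case (p, w) of ((x, y), (u, v)) \<Rightarrow> y \<equiv>\<^sub>r u * x \<and> 1 + y \<equiv>\<^sub>r v * (1 + x))"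

text \<open>
  The relation \<open>ratios\<close> is a bijection between \<open>pairs\<close> and the pairs of distinct elements
  of \<open>K - {1}\<close>. Given \<open>u, v\<close>, subtracting \<open>y = u x\<close> from \<open>1 + y = v (1 + x)\<close> yields \<open>(u - v) x = v - 1\<close>.
\<close>

lemma card_pairs: "card pairs = (k - 1) * (k - 2)"
proof -
  define D where "D = {(u, v). u \<in> K - {1} \<and> v \<in> K - {1} \<and> u \<noteq> v}"
  have card_D: "card D = (k - 1) * (k - 2)"
    unfolding D_def using finite_K card_K_minus_1 by (subst card_off_diagonal) (simp_all add: numeral_2_eq_2)
  have fin_D: "finite D"
    by (rule finite_subset[of _ "K \<times> K"]) (auto simp: D_def finite_K)
  have fin_P: "finite pairs"
    by (rule finite_subset[of _ "S \<times> S"]) (auto simp: pairs_def finite_S)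
  have KU: "u \<in> U" if "u \<in> K" for u using that K_sub by blast
  have "card pairs \<le> card D"
  proof (rule card_le_if_inj_on_rel[OF fin_D, of _ ratios])
    fix p assume "p \<in> pairs"
    then obtain x y where p: "p = (x, y)" "x \<in> S" "y \<in> S" "x \<noteq> y"
      and eq: "y ^ k \<equiv>\<^sub>r x ^ k" "(1 + y) ^ k \<equiv>\<^sub>r (1 + x) ^ k"
      by (auto simp: pairs_def cell_eq_iff)
    obtain u v where u: "u \<in> K" "y \<equiv>\<^sub>r u * x" and v: "v \<in> K" "1 + y \<equiv>\<^sub>r v * (1 + x)"
      using ratio_in_K eq S_units p by meson
    have "u \<noteq> 1" using u(2) S_eqI[of y x] p by auto
    moreover have "v \<noteq> 1"
    proof
      assume "v = 1"
      then have "1 + y \<equiv>\<^sub>r 1 + x" using v(2) by simp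
      then have "y \<equiv>\<^sub>r x" by (rule cong_multiple[of _ _ _ _ _ 1]) simp
      then show False using S_eqI p by blast
    qed
    moreover have "u \<noteq> v"
    proof
      assume "u = v"
      have "int r dvd (1 + y - v * (1 + x)) - (y - u * x)"
        using u(2) v(2) unfolding cong_iff_dvd_diff by (rule dvd_diff[rotated])
      then have "1 \<equiv>\<^sub>r u" unfolding \<open>u = v\<close> cong_iff_dvd_diff by (simp add: algebra_simps)
      then show False using U_eqI[of 1 u] KU[OF u(1)] KU[OF one_in_K] \<open>u \<noteq> 1\<close> by simp
    qed
    ultimately show "\<exists>w. w \<in> D \<and> ratios p w"
      using u v p(1) by (intro exI[of _ "(u, v)"]) (simp add: D_def ratios_def)
  next
    fix p p' w assume "p \<in> pairs" "p' \<in> pairs" "w \<in> D" "ratios p w" "ratios p' w"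
    then obtain x y x' y' u v where p: "p = (x, y)" "p' = (x', y')" "w = (u, v)"
      and S: "x \<in> S" "y \<in> S" "x' \<in> S" "y' \<in> S" and uv: "u \<in> K" "v \<in> K" "u \<noteq> v"
      and eq: "y \<equiv>\<^sub>r u * x" "1 + y \<equiv>\<^sub>r v * (1 + x)" "y' \<equiv>\<^sub>r u * x'" "1 + y' \<equiv>\<^sub>r v * (1 + x')"
      by (auto simp: pairs_def D_def ratios_def)
    have "int r dvd (y - u * x) - (1 + y - v * (1 + x)) - ((y' - u * x') - (1 + y' - v * (1 + x')))"
      using eq unfolding cong_iff_dvd_diff by (intro dvd_diff[OF dvd_diff dvd_diff])
    also have "\<dots> = x * (v - u) - x' * (v - u)" by (simp add: algebra_simps)
    finally have "x * (v - u) \<equiv>\<^sub>r x' * (v - u)" by (simp add: cong_iff_dvd_diff)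
    moreover have "\<not> int r dvd v - u"
      using U_eqI[of v u] KU uv by (auto simp: cong_iff_dvd_diff)
    ultimately have "x \<equiv>\<^sub>r x'" using cong_prime_cancel pr by blast
    then have "x = x'" using S_eqI S by blast
    then have "y \<equiv>\<^sub>r y'" using eq(1,3) by (metis cong_sym cong_trans)
    then show "p = p'" using S_eqI S p \<open>x = x'\<close> by blast
  qed
  moreover have "card D \<le> card pairs"
  proof (rule card_le_if_inj_on_rel[OF fin_P, of _ "\<lambda>w p. ratios p w"])
    fix w assume "w \<in> D"
    then obtain u v where w: "w = (u, v)" "u \<in> K" "v \<in> K" "u \<noteq> 1" "v \<noteq> 1" "u \<noteq> v"
      by (auto simp: D_def)
    have inc: "\<not> int r dvd a - b" if "a \<in> K" "b \<in> K" "a \<noteq> b" for a b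
      using U_eqI[of a b] KU that by (auto simp: cong_iff_dvd_diff)
    define s where "s = (u - v) ^ (r - 2)"
    have s: "s * (u - v) \<equiv>\<^sub>r 1" unfolding s_def using inc w by (intro fermat_inverse[OF r]) auto
    have ns: "\<not> int r dvd s" using s pr r3 by (auto dest!: eqr_unit simp: prime_dvd_mult_iff)
    have uU: "\<not> int r dvd u" "\<not> int r dvd v" using U_unit KU w by blast+
    \<comment> \<open>\<open>x = (v - 1) / (u - v)\<close>, since \<open>s\<close> inverts \<open>u - v\<close>.\<close>
    define x where "x = s * (v - 1)"
    have x1: "1 + x \<equiv>\<^sub>r s * (u - 1)"
      by (rule cong_multiple[OF s, of _ _ "-1"]) (simp add: x_def algebra_simps)
    have rel: "1 + u * x \<equiv>\<^sub>r v * (1 + x)"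
      by (rule cong_multiple[OF s, of _ _ "v - 1"]) (simp add: x_def algebra_simps)
    have nx: "\<not> int r dvd x" using ns inc[of v 1] w one_in_K pr by (simp add: x_def prime_dvd_mult_iff)
    have nx1: "\<not> int r dvd 1 + x"
      using eqr_unit[OF x1] ns inc[of u 1] w one_in_K pr by (simp add: prime_dvd_mult_iff)
    have ny: "\<not> int r dvd u * x" using nx uU pr by (simp add: prime_dvd_mult_iff)
    have ny1: "\<not> int r dvd 1 + u * x" using eqr_unit[OF rel] nx1 uU pr by (simp add: prime_dvd_mult_iff)
    let ?x = "x mod int r" and ?y = "(u * x) mod int r"
    have S: "?x \<in> S" "?y \<in> S" using mod_in_S nx nx1 ny ny1 by blast+
    have xy: "?y \<equiv>\<^sub>r u * ?x" by (simp add: cong_def mod_mult_right_eq)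
    have "1 + ?y \<equiv>\<^sub>r 1 + u * x" "v * (1 + ?x) \<equiv>\<^sub>r v * (1 + x)"
      by (intro cong_add cong_mult; simp)+
    then have xy1: "1 + ?y \<equiv>\<^sub>r v * (1 + ?x)" using rel cong_sym cong_trans by blast
    have "?x \<noteq> ?y"
    proof
      assume "?x = ?y"
      then have "u * x - x = 0 \<or> int r dvd u * x - x" by (simp add: mod_eq_dvd_iff dvd_diff_commute)
      then have "int r dvd (u - 1) * x" by (auto simp: algebra_simps)
      then show False using nx inc[of u 1] w one_in_K pr by (simp add: prime_dvd_mult_iff)
    qed
    moreover have "cell ?x = cell ?y"
      using pow_eq_of_ratio[OF w(2) xy] pow_eq_of_ratio[OF w(3) xy1] S by (simp add: cell_eq_iff)
    ultimately have "(?x, ?y) \<in> pairs" using S by (simp add: pairs_def)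
    then show "\<exists>p. p \<in> pairs \<and> ratios p w"
      using xy xy1 w(1) by (intro exI[of _ "(?x, ?y)"]) (simp add: ratios_def)
  next
    fix w w' p assume "w \<in> D" "w' \<in> D" "p \<in> pairs" "ratios p w" "ratios p w'"
    then obtain x y u v u' v' where p: "w = (u, v)" "w' = (u', v')" "p = (x, y)"
      and S: "x \<in> S" and uv: "u \<in> K" "v \<in> K" "u' \<in> K" "v' \<in> K"
      and eq: "y \<equiv>\<^sub>r u * x" "1 + y \<equiv>\<^sub>r v * (1 + x)" "y \<equiv>\<^sub>r u' * x" "1 + y \<equiv>\<^sub>r v' * (1 + x)"
      by (auto simp: pairs_def D_def ratios_def)
    have "u * x \<equiv>\<^sub>r u' * x" "v * (1 + x) \<equiv>\<^sub>r v' * (1 + x)"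
      using eq by (metis cong_sym cong_trans)+
    then have "u \<equiv>\<^sub>r u'" "v \<equiv>\<^sub>r v'" using cong_prime_cancel pr S_units[OF S] by blast+
    then show "w = w'" using U_eqI KU uv p by blast
  qed
  ultimately show ?thesis using card_D by simp
qed

section \<open>The row of minus one\<close>

definition neg_idx :: nat where "neg_idx = idx (int r - 1)"

lemma minus_one_U: "int r - 1 \<in> U" using r3 by auto

lemma minus_one_pow: "(int r - w) ^ k \<equiv>\<^sub>r (-1) ^ k * w ^ k"
proof -
  have "int r - w \<equiv>\<^sub>r - 1 * w" by (simp add: cong_iff_dvd_diff)
  then show ?thesis by (metis cong_pow power_mult_distrib)
qed

lemma neg_idx_less: "neg_idx < n" unfolding neg_idx_def by (rule idx_less[OF minus_one_U])

lemma neg_idx_power: "Q ^ (neg_idx * k) \<equiv>\<^sub>r (-1) ^ k"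
  using idx_power[OF minus_one_U] minus_one_pow[of 1] unfolding neg_idx_def
  by (metis cong_sym cong_trans mult.right_neutral power_one)

lemma minus_one_neq_one: "\<not> -1 \<equiv>\<^sub>r 1"
  using r3 by (auto simp: cong_iff_dvd_diff dest: zdvd_imp_le)

lemma delta_eq:
  assumes "i < n"
  shows "delta n k i = (if i = neg_idx then 1 else 0)"
proof (cases "even k")
  case True
  then have "Q ^ (neg_idx * k) \<equiv>\<^sub>r Q ^ (0 * k)" using neg_idx_power by simp
  then have "neg_idx = 0" using Q_power_inj neg_idx_less n by auto
  then show ?thesis using True by (simp add: delta_def)
next
  case False
  have "Q ^ ((2 * neg_idx) * k) \<equiv>\<^sub>r 1"
    using cong_pow[OF neg_idx_power, of 2] by (simp flip: power_mult add: ac_simps)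
  then have "Q ^ (((2 * neg_idx) mod n) * k) \<equiv>\<^sub>r Q ^ (0 * k)"
    using Q_power_mod[of "2 * neg_idx"] by (metis cong_sym cong_trans mult_0 power_0)
  then have "(2 * neg_idx) mod n = 0" using Q_power_inj n by auto
  then obtain c where c: "2 * neg_idx = n * c" by (auto elim!: dvdE)
  have "neg_idx \<noteq> 0"
  proof
    assume "neg_idx = 0"
    then have "1 \<equiv>\<^sub>r -1" using neg_idx_power False by simp
    then show False using minus_one_neq_one cong_sym by blast
  qed
  then have "c \<noteq> 0" using c by (intro notI) simp
  moreover have "n * c < n * 2" using c neg_idx_less by linarith
  ultimately have "c = 1" by auto
  then have "2 * neg_idx = n" using c by simp
  then show ?thesis using False by (auto simp: delta_def)
qed

definition neg_row :: "int set" where "neg_row = {x\<in>S. idx x = neg_idx}"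

lemma neg_row_eq: "neg_row = {x\<in>S. x ^ k \<equiv>\<^sub>r (-1) ^ k}"
proof -
  have "idx x = neg_idx \<longleftrightarrow> x ^ k \<equiv>\<^sub>r (-1) ^ k" if "x \<in> S" for x
    using idx_eq_iff[OF S_U(1)[OF that] neg_idx_less] neg_idx_power by (metis cong_sym cong_trans)
  then show ?thesis by (auto simp: neg_row_def)
qed

lemma finite_neg_row: "finite neg_row" by (simp add: neg_row_def finite_S)

text \<open>The row is \<open>-K\<close> without \<open>-1\<close>.\<close>

lemma card_neg_row: "card neg_row = k - 1"
proof -
  have sq: "(-1) ^ k * (-1) ^ k = (1::int)" by (simp flip: power_mult_distrib)
  have "bij_betw (\<lambda>w. int r - w) (K - {1}) neg_row"
  proof (rule bij_betw_byWitness[where f' = "\<lambda>w. int r - w"])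
    show "(\<lambda>w. int r - w) ` (K - {1}) \<subseteq> neg_row"
    proof (rule image_subsetI)
      fix w assume w: "w \<in> K - {1}"
      then have "(-1) ^ k * w ^ k \<equiv>\<^sub>r (-1) ^ k * 1" by (intro cong_scalar_left) (simp add: K_eq)
      then have "(int r - w) ^ k \<equiv>\<^sub>r (-1) ^ k" using minus_one_pow[of w] cong_trans by auto
      moreover have "int r - w \<in> S" using w K_sub by (auto simp: S_def)
      ultimately show "int r - w \<in> neg_row" by (simp add: neg_row_eq)
    qed
    show "(\<lambda>w. int r - w) ` neg_row \<subseteq> K - {1}"
    proof (rule image_subsetI)
      fix w assume w: "w \<in> neg_row"
      then have "(-1) ^ k * w ^ k \<equiv>\<^sub>r (-1) ^ k * (-1) ^ k" by (intro cong_scalar_left) (simp add: neg_row_eq)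
      then have "(int r - w) ^ k \<equiv>\<^sub>r 1" using minus_one_pow[of w] cong_trans sq by auto
      then show "int r - w \<in> K - {1}" using w by (auto simp: K_eq neg_row_def S_def)
    qed
  qed auto
  then show ?thesis using bij_betw_same_card card_K_minus_1 by metis
qed

definition t :: "nat \<times> nat \<Rightarrow> nat" where "t c = card {x\<in>S. cell x = c}"

definition num_cells :: "nat \<Rightarrow> nat" where "num_cells m = card {c \<in> {..<n} \<times> {..<n}. t c = m}"

definition num_row_cells :: "nat \<Rightarrow> nat" where "num_row_cells m = card {j \<in> {..<n}. t (neg_idx, j) = m}"

text \<open>Besides the inverse \<open>y\<close> of \<open>x\<close>, this records that \<open>1 + y = (1 + x) / x\<close>, on which the count in the row of \<open>-1\<close> rests.\<close>

lemma inverse_in_S: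
  assumes "x \<in> S"
  obtains y where "y \<in> S" "y * x \<equiv>\<^sub>r 1" "(1 + y) * x \<equiv>\<^sub>r 1 + x"
proof -
  define s where "s = x ^ (r - 2)"
  have s: "s * x \<equiv>\<^sub>r 1" unfolding s_def by (rule fermat_inverse[OF r S_units(1)[OF assms]])
  have s1: "(1 + s) * x \<equiv>\<^sub>r 1 + x"
    by (rule cong_multiple[OF s, of _ _ 1]) (simp add: algebra_simps)
  have "\<not> int r dvd s" using eqr_unit[OF s] r3 by (auto intro: dvd_mult2)
  moreover have "\<not> int r dvd 1 + s" using eqr_unit[OF s1] S_units(2)[OF assms] by (auto intro: dvd_mult2)
  ultimately have "s mod int r \<in> S" by (rule mod_in_S)
  moreover have "(s mod int r) * x \<equiv>\<^sub>r 1" using s by (simp add: cong_def mod_mult_left_eq)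
  moreover have "(1 + s mod int r) * x \<equiv>\<^sub>r (1 + s) * x"
    by (intro cong_mult cong_add) auto
  ultimately show ?thesis using that s1 cong_trans by blast
qed

lemma inverse_neq:
  assumes "x \<in> S" "x \<noteq> 1" "y * x \<equiv>\<^sub>r 1"
  shows "y \<noteq> x"
proof
  assume "y = x"
  then have "int r dvd (x - 1) * (1 + x)"
    using assms(3) by (simp add: cong_iff_dvd_diff algebra_simps)
  then have "x \<equiv>\<^sub>r 1" using S_units(2)[OF assms(1)] pr by (auto simp: prime_dvd_mult_iff cong_iff_dvd_diff)
  then show False using assms U_eqI[of x 1] S_U r3 by auto
qed

end

section \<open>Cell counts for primes outside the exceptional set\<close>

locale generic_period_setting = period_setting +
  assumes no_three: "\<And>x y z M. x \<in> S \<Longrightarrow> y \<in> S \<Longrightarrow> z \<in> S \<Longrightarrow> M = k \<or> M = 2 * k \<Longrightarrow> M dvd r - 1 \<Longrightarrow>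
    y ^ M \<equiv>\<^sub>r x ^ M \<Longrightarrow> z ^ M \<equiv>\<^sub>r x ^ M \<Longrightarrow>
    (1 + y) ^ M \<equiv>\<^sub>r (1 + x) ^ M \<Longrightarrow> (1 + z) ^ M \<equiv>\<^sub>r (1 + x) ^ M \<Longrightarrow> x = y \<or> x = z \<or> y = z"
begin

lemma no_three_in_cell:
  "x \<in> S \<Longrightarrow> y \<in> S \<Longrightarrow> z \<in> S \<Longrightarrow> cell x = cell y \<Longrightarrow> cell x = cell z \<Longrightarrow> x = y \<or> x = z \<or> y = z"
  using no_three[of x y z k] k_dvd cell_eq_iff[of x y] cell_eq_iff[of x z] by blast

lemma t_le_2: "t c \<le> 2"
  unfolding t_def using no_three_in_cell finite_S by (intro card_le_2I) auto

lemma total_counts: "num_cells 1 + 2 * num_cells 2 = n * k - 1" "2 * num_cells 2 = (k - 1) * (k - 2)"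
proof -
  note counts = fibre_counts[OF finite_S _ cell_in, folded t_def num_cells_def pairs_def, unfolded card_S card_pairs]
  show "num_cells 1 + 2 * num_cells 2 = n * k - 1" "2 * num_cells 2 = (k - 1) * (k - 2)"
    by (rule counts; use t_le_2 in simp)+
qed

lemma row_fibre: "{x\<in>neg_row. idx (1 + x) = j} = {x\<in>S. cell x = (neg_idx, j)}"
  by (auto simp: neg_row_def cell_def)

lemma row_counts: "num_row_cells 1 + 2 * num_row_cells 2 = k - 1"
  "2 * num_row_cells 2 = card {(x, y). x \<in> neg_row \<and> y \<in> neg_row \<and> x \<noteq> y \<and> cell x = cell y}"
proof -
  have im: "(\<lambda>x. idx (1 + x)) ` neg_row \<subseteq> {..<n}" using S_U idx_less by (auto simp: neg_row_def)
  have eq: "{(x, y). x \<in> neg_row \<and> y \<in> neg_row \<and> x \<noteq> y \<and> cell x = cell y} =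
    {(x, y). x \<in> neg_row \<and> y \<in> neg_row \<and> x \<noteq> y \<and> idx (1 + x) = idx (1 + y)}"
    by (auto simp: neg_row_def cell_def)
  have fib: "card {x\<in>neg_row. idx (1 + x) = j} = t (neg_idx, j)" for j
    by (simp only: row_fibre t_def)
  note counts = fibre_counts[OF finite_neg_row finite_lessThan im, unfolded fib, OF t_le_2]
  show "num_row_cells 1 + 2 * num_row_cells 2 = k - 1"
    using counts(1) by (simp only: num_row_cells_def card_neg_row)
  show "2 * num_row_cells 2 = card {(x, y). x \<in> neg_row \<and> y \<in> neg_row \<and> x \<noteq> y \<and> cell x = cell y}"
    using counts(2) by (simp only: num_row_cells_def eq)
qed

text \<open>
  For even \<open>k\<close> the row is \<open>K - {-1}\<close>, and \<open>x\<close> and \<open>1 / x\<close> share a cell because \<open>1 + 1 / x = (1 + x) / x\<close>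
  with \<open>x \<in> K\<close>. No third element fits, so \<open>1 / x\<close> is the only partner of \<open>x \<noteq> 1\<close>; a partner \<open>y\<close>
  of \<open>1\<close> would bring \<open>1 / y\<close> as a third element.
\<close>

lemma row_counts_even:
  assumes "even k"
  shows "num_row_cells 1 = 1" "2 * num_row_cells 2 = k - 2"
proof -
  have neg_row: "x \<in> neg_row \<longleftrightarrow> x \<in> S \<and> x ^ k \<equiv>\<^sub>r 1" for x using assms by (auto simp: neg_row_eq)
  have one: "1 \<in> neg_row" using r3 by (simp add: neg_row S_def)
  have inv: "\<exists>y. y \<in> neg_row \<and> cell x = cell y \<and> y * x \<equiv>\<^sub>r 1" if x: "x \<in> neg_row" for x
  proof -
    obtain y where y: "y \<in> S" "y * x \<equiv>\<^sub>r 1" "(1 + y) * x \<equiv>\<^sub>r 1 + x"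
      using inverse_in_S x neg_row by blast
    have xK: "x \<in> K" using x S_U by (simp add: neg_row K_eq)
    have "1 \<equiv>\<^sub>r x * y" "1 + x \<equiv>\<^sub>r x * (1 + y)"
      using y(2,3) by (simp_all only: cong_sym mult.commute[of x])
    then have pw: "1 ^ k \<equiv>\<^sub>r y ^ k" "(1 + x) ^ k \<equiv>\<^sub>r (1 + y) ^ k"
      using pow_eq_of_ratio[OF xK] by blast+
    have "x ^ k \<equiv>\<^sub>r 1" using x neg_row by blast
    moreover have "y ^ k \<equiv>\<^sub>r 1" using pw(1) by (simp add: cong_sym)
    ultimately have "y ^ k \<equiv>\<^sub>r 1" "y ^ k \<equiv>\<^sub>r x ^ k" "(1 + y) ^ k \<equiv>\<^sub>r (1 + x) ^ k"
      using cong_trans cong_sym pw(2) by blast+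
    then show ?thesis using x y neg_row by (auto simp: cell_eq_iff)
  qed
  let ?P = "{(x, y). x \<in> neg_row \<and> y \<in> neg_row \<and> x \<noteq> y \<and> cell x = cell y}"
  have neg_row_S: "x \<in> neg_row \<Longrightarrow> x \<in> S" for x by (simp add: neg_row)
  have fst_ne: "x \<noteq> 1" if "(x, y) \<in> ?P" for x y
  proof
    assume "x = 1"
    then have y: "y \<in> neg_row" "y \<noteq> 1" "cell 1 = cell y" using that by auto
    obtain z where z: "z \<in> neg_row" "cell y = cell z" "z * y \<equiv>\<^sub>r 1" using inv y by blast
    have "z \<noteq> y" using inverse_neq z(3) y neg_row_S by blast
    moreover have "z \<noteq> 1" using z(3) y U_eqI[of y 1] S_U one neg_row_S by auto
    ultimately show False using no_three_in_cell[of 1 y z] one y z neg_row_S by auto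
  qed
  have "bij_betw fst ?P (neg_row - {1})"
    unfolding bij_betw_def
  proof
    show "inj_on fst ?P"
    proof (rule inj_onI)
      fix p p' assume "p \<in> ?P" "p' \<in> ?P" "fst p = fst p'"
      then obtain x y z where "p = (x, y)" "p' = (x, z)" "x \<in> neg_row" "y \<in> neg_row" "z \<in> neg_row" "x \<noteq> y" "x \<noteq> z"
        "cell x = cell y" "cell x = cell z" by auto
      then show "p = p'" using no_three_in_cell[of x y z] neg_row_S by auto
    qed
    show "fst ` ?P = neg_row - {1}"
    proof (intro equalityI subsetI)
      fix x assume "x \<in> fst ` ?P"
      then show "x \<in> neg_row - {1}" using fst_ne by auto
    next
      fix x assume x: "x \<in> neg_row - {1}"
      then obtain y where "y \<in> neg_row" "cell x = cell y" "y * x \<equiv>\<^sub>r 1" using inv by blast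
      then have "(x, y) \<in> ?P" using inverse_neq x neg_row_S by auto
      then show "x \<in> fst ` ?P" by force
    qed
  qed
  then have "card ?P = k - 2"
    using one finite_neg_row card_neg_row by (simp add: bij_betw_same_card)
  then show *: "2 * num_row_cells 2 = k - 2" using row_counts(2) by simp
  show "num_row_cells 1 = 1" using row_counts(1) * assms k by (cases "k = 1") auto
qed

text \<open>
  For odd \<open>k\<close>, suppose \<open>x, y\<close> in the row share a cell and let \<open>z = 1 / x\<close>. Then \<open>x, y, z\<close> have equal
  \<open>2 k\<close>-th powers, also after adding \<open>1\<close>, so \<open>z = y\<close>. But \<open>(1 + z)\<^sup>k = (1 + x)\<^sup>k / x\<^sup>k = - (1 + x)\<^sup>k\<close>,
  so \<open>1 + y\<close> and \<open>1 + x\<close> lie in different cosets of \<open>K\<close>.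
\<close>

lemma row_counts_odd:
  assumes "odd k"
  shows "num_row_cells 1 = k - 1" "num_row_cells 2 = 0"
proof -
  have "2 * neg_idx = n"
    using delta_eq[OF neg_idx_less] assms by (simp add: delta_def split: if_splits)
  then have "even n" by (metis dvd_triv_left)
  then have dvd: "2 * k dvd r - 1" by (auto simp: r_eq)
  have False if xy: "x \<in> neg_row" "y \<in> neg_row" "x \<noteq> y" "cell x = cell y" for x y
  proof -
    have S: "x \<in> S" "y \<in> S" and pw: "x ^ k \<equiv>\<^sub>r -1" "y ^ k \<equiv>\<^sub>r -1"
      using xy assms by (auto simp: neg_row_eq)
    have eq: "(1 + y) ^ k \<equiv>\<^sub>r (1 + x) ^ k" using xy S by (simp add: cell_eq_iff)
    have sq: "a ^ (2 * k) \<equiv>\<^sub>r b ^ (2 * k)" if "a ^ k \<equiv>\<^sub>r b ^ k" for a b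
      using cong_pow[OF that, of 2] by (simp add: mult.commute flip: power_mult)
    have m1: "a ^ (2 * k) \<equiv>\<^sub>r 1" if "a ^ k \<equiv>\<^sub>r -1" for a
      using cong_pow[OF that, of 2] by (simp add: mult.commute flip: power_mult)
    obtain z where z: "z \<in> S" "z * x \<equiv>\<^sub>r 1" "(1 + z) * x \<equiv>\<^sub>r 1 + x" using inverse_in_S[OF S(1)] .
    have absorb: "a \<equiv>\<^sub>r b" if "a * x ^ (2 * k) \<equiv>\<^sub>r b" for a b
    proof -
      have "a * x ^ (2 * k) \<equiv>\<^sub>r a * 1" by (intro cong_scalar_left m1 pw)
      then have "a \<equiv>\<^sub>r a * x ^ (2 * k)" by (simp add: cong_sym)
      then show ?thesis using that by (rule cong_trans)
    qed
    have z2: "z ^ (2 * k) \<equiv>\<^sub>r 1" "(1 + z) ^ (2 * k) \<equiv>\<^sub>r (1 + x) ^ (2 * k)"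
      using cong_pow[OF z(2), of "2 * k"] cong_pow[OF z(3), of "2 * k"]
      by (simp_all add: power_mult_distrib absorb)
    have "1 \<equiv>\<^sub>r x ^ (2 * k)" using m1[OF pw(1)] by (rule cong_sym)
    then have zx: "z ^ (2 * k) \<equiv>\<^sub>r x ^ (2 * k)" "y ^ (2 * k) \<equiv>\<^sub>r x ^ (2 * k)"
      using cong_trans z2(1) m1[OF pw(2)] by blast+
    then have "x = y \<or> x = z \<or> y = z"
      using no_three[OF S z(1) _ dvd zx(2,1) sq[OF eq] z2(2)] by simp
    moreover have "x \<noteq> 1" using pw(1) minus_one_neq_one by (auto simp: cong_sym)
    ultimately have "z = y" using xy(3) inverse_neq[OF S(1) _ z(2)] by blast
    have "(1 + y) ^ k * x ^ k \<equiv>\<^sub>r (1 + x) ^ k"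
      using cong_pow[OF z(3), of k] by (simp add: power_mult_distrib \<open>z = y\<close>)
    moreover have "(1 + y) ^ k * x ^ k \<equiv>\<^sub>r (1 + x) ^ k * - 1" using eq pw by (intro cong_mult)
    ultimately have "(1 + x) ^ k * - 1 \<equiv>\<^sub>r (1 + x) ^ k" using cong_sym cong_trans by blast
    then have "- 1 * (1 + x) ^ k \<equiv>\<^sub>r 1 * (1 + x) ^ k" by simp
    moreover have "\<not> int r dvd (1 + x) ^ k" using S_units(2)[OF S(1)] pr prime_dvd_power by blast
    ultimately show False using cong_prime_cancel pr minus_one_neq_one by blast
  qed
  then have "{(x, y). x \<in> neg_row \<and> y \<in> neg_row \<and> x \<noteq> y \<and> cell x = cell y} = {}" by blast
  then have "2 * num_row_cells 2 = 0" by (simp only: row_counts(2) card.empty)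
  then show "num_row_cells 2 = 0" by simp
  then show "num_row_cells 1 = k - 1" using row_counts(1) by simp
qed

end

section \<open>The complexity\<close>

lemma card_nonzero_le_2:
  fixes f :: "'a \<Rightarrow> nat"
  assumes "finite I" "\<And>c. f c \<le> 2"
  shows "card {c\<in>I. f c \<noteq> 0} = card {c\<in>I. f c = 1} + card {c\<in>I. f c = 2}"
proof -
  have "f c \<noteq> 0 \<longleftrightarrow> f c = 1 \<or> f c = 2" for c using assms(2)[of c] by linarith
  then have "{c\<in>I. f c \<noteq> 0} = {c\<in>I. f c = 1} \<union> {c\<in>I. f c = 2}" by blast
  then show ?thesis using assms(1) by (simp only:) (rule card_Un_disjoint; auto)
qed

context generic_period_setting
begin

lemma cyclotomic_number_t: "i < n \<Longrightarrow> j < n \<Longrightarrow> cyclotomic_number r q K i j = t (i, j)"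
  by (simp add: cyclotomic_number_eq t_def)

text \<open>
  Without the \<open>\<delta>\<close> correction the complexity would count the cells with \<open>t\<close> nonzero modulo \<open>p\<close>; in the row of
  \<open>-1\<close> the condition becomes that \<open>t\<close> and \<open>k\<close> differ modulo \<open>p\<close>.
\<close>

lemma complexity_row_exchange:
  "complexity n k p q K + card {j\<in>{..<n}. \<not> [int (t (neg_idx, j)) = 0] (mod int p)} =
    card {c\<in>{..<n} \<times> {..<n}. \<not> [int (t c) = 0] (mod int p)} +
    card {j\<in>{..<n}. \<not> [int (t (neg_idx, j)) = int k] (mod int p)}"
proof -
  define I where "I = {..<n} \<times> {..<n}"
  define A where "A = {c\<in>I. fst c \<noteq> neg_idx \<and> \<not> [int (t c) = 0] (mod int p)}"
  define B0 where "B0 = {j\<in>{..<n}. \<not> [int (t (neg_idx, j)) = 0] (mod int p)}"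
  define B1 where "B1 = {j\<in>{..<n}. \<not> [int (t (neg_idx, j)) = int k] (mod int p)}"
  have fin: "finite A" "finite B0" "finite B1" by (simp_all add: A_def B0_def B1_def I_def)
  have row: "card (A \<union> Pair neg_idx ` B) = card A + card B" if "finite B" for B
    using that fin(1) by (subst card_Un_disjoint) (auto simp: A_def card_image inj_on_def)
  have "i < n \<and> j < n \<and>
       \<not> [int (cyclotomic_number (n * k + 1) q K i j) - int k * int (delta n k i) = 0] (mod int p)
    \<longleftrightarrow> (i, j) \<in> A \<union> Pair neg_idx ` B1" for i j
  proof (cases "i < n \<and> j < n")
    case True
    then have "cyclotomic_number (n * k + 1) q K i j = t (i, j)"
      using cyclotomic_number_t by (simp only: r_eq)
    with True show ?thesis
      by (cases "i = neg_idx") (auto simp: A_def B1_def I_def delta_eq cong_iff_dvd_diff)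
  next
    case False
    then show ?thesis using neg_idx_less by (auto simp: A_def B1_def I_def)
  qed
  then have "{(i, j). i < n \<and> j < n \<and>
       \<not> [int (cyclotomic_number (n * k + 1) q K i j) - int k * int (delta n k i) = 0] (mod int p)}
    = A \<union> Pair neg_idx ` B1" by auto
  then have "complexity n k p q K = card A + card B1"
    using row fin(3) by (simp add: complexity_def)
  moreover have "{c\<in>I. \<not> [int (t c) = 0] (mod int p)} = A \<union> Pair neg_idx ` B0"
    using neg_idx_less by (auto simp: A_def B0_def I_def)
  then have "card {c\<in>I. \<not> [int (t c) = 0] (mod int p)} = card A + card B0"
    using row fin(2) by simp
  ultimately show ?thesis by (simp add: I_def B0_def B1_def)
qed

lemma card_t_nonzero: "card {c\<in>{..<n} \<times> {..<n}. t c \<noteq> 0} = num_cells 1 + num_cells 2"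
  "card {j\<in>{..<n}. t (neg_idx, j) \<noteq> 0} = num_row_cells 1 + num_row_cells 2"
  unfolding num_cells_def num_row_cells_def by (rule card_nonzero_le_2; simp add: t_le_2)+

lemma card_row_complement:
  "real (card {j\<in>{..<n}. t (neg_idx, j) \<noteq> m}) = real n - real (num_row_cells m)"
proof -
  have "{j\<in>{..<n}. t (neg_idx, j) \<noteq> m} = {..<n} - {j\<in>{..<n}. t (neg_idx, j) = m}" by auto
  moreover have sub: "{j\<in>{..<n}. t (neg_idx, j) = m} \<subseteq> {..<n}" by auto
  ultimately have "card {j\<in>{..<n}. t (neg_idx, j) \<noteq> m} = n - num_row_cells m"
    unfolding num_row_cells_def using card_Diff_subset[OF finite_subset[OF sub] sub] by simp
  moreover have "num_row_cells m \<le> n" unfolding num_row_cells_def using card_mono[OF _ sub] by simp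
  ultimately show ?thesis by simp
qed

lemma num_cells_values:
  "2 * real (num_cells 2) = (real k - 1) * (real k - 2)"
  "real (num_cells 1) = real n * real k - 1 - (real k - 1) * (real k - 2)"
proof -
  have nk: "1 \<le> n * k" using r3 r_eq by linarith
  have "real ((k - 1) * (k - 2)) = (real k - 1) * (real k - 2)"
    using k by (cases "k = 1") (auto simp: of_nat_diff)
  then show *: "2 * real (num_cells 2) = (real k - 1) * (real k - 2)"
    using total_counts(2) by (metis of_nat_mult of_nat_numeral)
  have "real (num_cells 1 + 2 * num_cells 2) = real (n * k) - 1"
    using total_counts(1) nk by (simp add: of_nat_diff)
  then show "real (num_cells 1) = real n * real k - 1 - (real k - 1) * (real k - 2)"
    using * by simp
qed

lemma num_row_cells_values:
  "even k \<Longrightarrow> real (num_row_cells 1) = 1" "even k \<Longrightarrow> 2 * real (num_row_cells 2) = real k - 2"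
  "odd k \<Longrightarrow> real (num_row_cells 1) = real k - 1" "odd k \<Longrightarrow> real (num_row_cells 2) = 0"
proof -
  show "real (num_row_cells 1) = 1" if "even k" using row_counts_even that by simp
  show "real (num_row_cells 1) = real k - 1" "real (num_row_cells 2) = 0" if "odd k" 
    using row_counts_odd that k by (simp_all add: of_nat_diff)
  show "2 * real (num_row_cells 2) = real k - 2" if "even k"
  proof -
    have "2 \<le> k" using k that by (cases "k = 1") auto
    then have "real (2 * num_row_cells 2) = real k - 2" using row_counts_even(2) that by (simp add: of_nat_diff)
    then show ?thesis by simp
  qed
qed

text \<open>
  For \<open>p > 2\<close> the values \<open>0, 1, 2\<close> of \<open>t\<close> are distinct modulo \<open>p\<close>, so the entries of the row of \<open>-1\<close> that
  vanish are those with \<open>t\<close> equal to the residue \<open>m \<le> 2\<close> of \<open>k\<close>, if there is one.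
\<close>

lemma complexity_odd_char:
  assumes "p > 2"
  shows "real (complexity n k p q K) = real (num_cells 1) + real (num_cells 2) +
    (if [k = 0] (mod p) then 0 else real n - real (num_row_cells 1) - real (num_row_cells 2) -
      (if [k = 1] (mod p) then real (num_row_cells 1) else if [k = 2] (mod p) then real (num_row_cells 2) else 0))"
proof -
  have res: "[int m = int m'] (mod int p) \<longleftrightarrow> m = m'" if "m \<le> 2" "m' \<le> 2" for m m' :: nat
  proof -
    have "m mod p = m" "m' mod p = m'" using that assms by auto
    then have "[m = m'] (mod p) \<longleftrightarrow> m = m'" by (simp add: cong_def)
    then show ?thesis by (simp only: cong_int_iff)
  qed
  have zero: "[int (t c) = 0] (mod int p) \<longleftrightarrow> t c = 0" for c
    using res[of "t c" 0] t_le_2 by simp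
  have tk: "[int (t c) = int k] (mod int p) \<longleftrightarrow> t c = m" if "[k = m] (mod p)" "m \<le> 2" for c m
  proof -
    have "[int k = int m] (mod int p)" using that(1) by (simp only: cong_int_iff)
    then have "[int (t c) = int k] (mod int p) \<longleftrightarrow> [int (t c) = int m] (mod int p)"
      using cong_trans cong_sym by blast
    then show ?thesis using res[OF t_le_2 that(2)] by simp
  qed
  note ex = complexity_row_exchange[of p, unfolded zero card_t_nonzero]
  consider m where "m \<le> 2" "[k = m] (mod p)" | "\<And>m. m \<le> 2 \<Longrightarrow> \<not> [k = m] (mod p)" by blast
  then show ?thesis
  proof cases
    case 1
    have km: "[k = m'] (mod p) \<longleftrightarrow> m' = m" if "m' \<le> 2" for m'
    proof -
      have "[k = m'] (mod p) \<longleftrightarrow> [m' = m] (mod p)" using 1(2) cong_trans cong_sym by blast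
      then show ?thesis using res[OF that 1(1)] by (simp only: cong_int_iff)
    qed
    have ks: "[k = 0] (mod p) \<longleftrightarrow> m = 0" "[k = 1] (mod p) \<longleftrightarrow> m = 1" "[k = 2] (mod p) \<longleftrightarrow> m = 2"
      using km[of 0] km[of 1] km[of 2] by auto
    have e: "real (complexity n k p q K) + real (num_row_cells 1 + num_row_cells 2) =
      real (num_cells 1 + num_cells 2) + real (card {j\<in>{..<n}. t (neg_idx, j) \<noteq> m})"
      using arg_cong[OF ex[unfolded tk[OF 1(2,1)]], of real] by (simp only: of_nat_add)
    show ?thesis
    proof (cases "m = 0")
      case True
      with e have "real (complexity n k p q K) + real (num_row_cells 1 + num_row_cells 2) = real (num_cells 1 + num_cells 2) + real (num_row_cells 1 + num_row_cells 2)"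
        by (simp only: card_t_nonzero)
      then show ?thesis using True by (simp add: ks)
    next
      case False
      then have "m = 1 \<or> m = 2" using 1(1) by auto
      then show ?thesis using e[unfolded card_row_complement] ks by auto
    qed
  next
    case 2
    have "\<not> [int (t c) = int k] (mod int p)" for c
      using 2[OF t_le_2[of c]] by (simp add: cong_int_iff cong_sym_eq)
    then have "{j\<in>{..<n}. \<not> [int (t (neg_idx, j)) = int k] (mod int p)} = {..<n}" by blast
    then have nat_eq: "complexity n k p q K + (num_row_cells 1 + num_row_cells 2) = num_cells 1 + num_cells 2 + n"
      using ex by (simp only: card_lessThan)
    have "\<not> [k = 0] (mod p)" "\<not> [k = 1] (mod p)" "\<not> [k = 2] (mod p)" using 2 by auto
    then show ?thesis using arg_cong[OF nat_eq, of real] by simp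
  qed
qed

text \<open>Modulo \<open>2\<close> only \<open>t = 1\<close> is nonzero, and \<open>t - k\<close> is nonzero iff \<open>t\<close> and \<open>k\<close> have different parity.\<close>

lemma complexity_char_2:
  "real (complexity n k 2 q K) = real (num_cells 1) + (if even k then 0 else real n - 2 * real (num_row_cells 1))"
proof -
  have zero: "\<not> [int (t c) = 0] (mod int 2) \<longleftrightarrow> t c = 1" for c
    using t_le_2[of c] by (auto simp: cong_iff_dvd_diff le_Suc_eq numeral_2_eq_2)
  have tk: "\<not> [int (t c) = int k] (mod int 2) \<longleftrightarrow> (if even k then t c = 1 else t c \<noteq> 1)" for c
    using t_le_2[of c] by (auto simp: cong_iff_dvd_diff le_Suc_eq numeral_2_eq_2)
  have e: "real (complexity n k 2 q K) + real (num_row_cells 1) =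
    real (num_cells 1) + real (card {j\<in>{..<n}. if even k then t (neg_idx, j) = 1 else t (neg_idx, j) \<noteq> 1})"
    using arg_cong[OF complexity_row_exchange[of 2, unfolded zero tk, folded num_cells_def num_row_cells_def], of real]
    by (simp only: of_nat_add)
  show ?thesis
  proof (cases "even k")
    case True
    then show ?thesis using e by (simp only: if_True flip: num_row_cells_def)
  next
    case False
    then show ?thesis using e by (simp only: if_False card_row_complement)
  qed
qed

lemma complexity_formulas:
  shows "even k \<longrightarrow>
        (p = 2 \<longrightarrow>
          real (complexity n k p q K) = real n * real k - real k ^ 2 + 3 * real k - 3) \<and>
        (p > 2 \<and> [k = 0] (mod p) \<longrightarrow>
          real (complexity n k p q K) =
            real n * real k - 1/2 * real k ^ 2 + 3/2 * real k - 2) \<and>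
        (p > 2 \<and> [k = 1] (mod p) \<longrightarrow>
          real (complexity n k p q K) =
            real n * (real k + 1) - 1/2 * real k ^ 2 + real k - 3) \<and>
        (p > 2 \<and> [k = 2] (mod p) \<longrightarrow>
          real (complexity n k p q K) =
            real n * (real k + 1) - 1/2 * real k ^ 2 + 1/2 * real k - 1) \<and>
        (p > 2 \<and> \<not> [k = 0] (mod p) \<and> \<not> [k = 1] (mod p) \<and> \<not> [k = 2] (mod p) \<longrightarrow>
          real (complexity n k p q K) =
            real n * (real k + 1) - 1/2 * real k ^ 2 + real k - 2)" (is ?even)
    and "odd k \<longrightarrow>
        (p = 2 \<longrightarrow>
          real (complexity n k p q K) = real n * (real k + 1) - real k ^ 2 + real k - 1) \<and>
        (p > 2 \<and> [k = 0] (mod p) \<longrightarrow>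
          real (complexity n k p q K) =
            real n * real k - 1/2 * real k ^ 2 + 3/2 * real k - 2) \<and>
        (p > 2 \<and> [k = 1] (mod p) \<longrightarrow>
          real (complexity n k p q K) =
            real n * (real k + 1) - 1/2 * real k ^ 2 - 1/2 * real k) \<and>
        (p > 2 \<and> \<not> [k = 0] (mod p) \<and> \<not> [k = 1] (mod p) \<longrightarrow>
          real (complexity n k p q K) =
            real n * (real k + 1) - 1/2 * real k ^ 2 + 1/2 * real k - 1)" (is ?odd)
proof -
  have excl: "\<not> [k = 0] (mod p)" "\<not> [k = 1] (mod p)" if "p > 2" "[k = 2] (mod p)"
    using that by (auto simp: cong_def)
  have excl1: "\<not> [k = 0] (mod p)" if "p > 2" "[k = 1] (mod p)"
    using that by (auto simp: cong_def)
  have sq: "(real k - 1) * (real k - 2) = real k ^ 2 - 3 * real k + 2"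
    by (simp add: power2_eq_square algebra_simps)
  have T: "real (num_cells 2) = real k ^ 2 / 2 - 3 / 2 * real k + 1"
    "real (num_cells 1) = real n * real k - real k ^ 2 + 3 * real k - 3"
    using num_cells_values sq by simp_all
  have T02: "even k \<Longrightarrow> real (num_row_cells 2) = real k / 2 - 1" using num_row_cells_values(2) by simp
  show ?even
    by (intro impI conjI; (elim conjE)?)
      (simp_all add: complexity_odd_char complexity_char_2 T num_row_cells_values(1) T02 excl excl1 distrib_left del: One_nat_def)
  show ?odd
    by (intro impI conjI; (elim conjE)?; cases "[k = 2] (mod p)")
      (simp_all add: complexity_odd_char complexity_char_2 T num_row_cells_values(3,4) excl excl1 distrib_left del: One_nat_def)
qed

end

theorem mainTheorem1:
  fixes k :: nat
  assumes "k \<ge> 1"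
  shows "\<exists>E :: nat set. finite E \<and> (\<forall>e\<in>E. prime e) \<and>
    (\<forall>(n::nat) (r::nat) (p::nat) (m::nat) (q::nat) (K::int set).
      n > 1 \<and> r = n * k + 1 \<and> prime r \<and> r \<notin> E \<and>
      prime p \<and> m \<ge> 1 \<and> q = p ^ m \<and> \<not> r dvd q \<and>
      subgroup K (Zmod_units r) \<and> card K = k \<and>
      generate (Zmod_units r) (insert (residue_class r q) K) = carrier (Zmod_units r)
      \<longrightarrow>
      (\<forall>i<n. \<forall>j<n. cyclotomic_number r q K i j \<le> 2) \<and>
      (even k \<longrightarrow>
        (p = 2 \<longrightarrow>
          real (complexity n k p q K) = real n * real k - real k ^ 2 + 3 * real k - 3) \<and>
        (p > 2 \<and> [k = 0] (mod p) \<longrightarrow>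
          real (complexity n k p q K) =
            real n * real k - 1/2 * real k ^ 2 + 3/2 * real k - 2) \<and>
        (p > 2 \<and> [k = 1] (mod p) \<longrightarrow>
          real (complexity n k p q K) =
            real n * (real k + 1) - 1/2 * real k ^ 2 + real k - 3) \<and>
        (p > 2 \<and> [k = 2] (mod p) \<longrightarrow>
          real (complexity n k p q K) =
            real n * (real k + 1) - 1/2 * real k ^ 2 + 1/2 * real k - 1) \<and>
        (p > 2 \<and> \<not> [k = 0] (mod p) \<and> \<not> [k = 1] (mod p) \<and> \<not> [k = 2] (mod p) \<longrightarrow>
          real (complexity n k p q K) =
            real n * (real k + 1) - 1/2 * real k ^ 2 + real k - 2)) \<and>
      (odd k \<longrightarrow>
        (p = 2 \<longrightarrow>
          real (complexity n k p q K) = real n * (real k + 1) - real k ^ 2 + real k - 1) \<and>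
        (p > 2 \<and> [k = 0] (mod p) \<longrightarrow>
          real (complexity n k p q K) =
            real n * real k - 1/2 * real k ^ 2 + 3/2 * real k - 2) \<and>
        (p > 2 \<and> [k = 1] (mod p) \<longrightarrow>
          real (complexity n k p q K) =
            real n * (real k + 1) - 1/2 * real k ^ 2 - 1/2 * real k) \<and>
        (p > 2 \<and> \<not> [k = 0] (mod p) \<and> \<not> [k = 1] (mod p) \<longrightarrow>
          real (complexity n k p q K) =
            real n * (real k + 1) - 1/2 * real k ^ 2 + 1/2 * real k - 1)))"
proof -
  obtain E1 E2 :: "nat set" where fin: "finite E1" "finite E2"
    and E1: "\<And>r x y z. prime r \<Longrightarrow> r \<notin> E1 \<Longrightarrow> k dvd r - 1 \<Longrightarrow>
      x \<in> {0<..<int r - 1} \<Longrightarrow> y \<in> {0<..<int r - 1} \<Longrightarrow> z \<in> {0<..<int r - 1} \<Longrightarrow>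
      [y ^ k = x ^ k] (mod int r) \<Longrightarrow> [z ^ k = x ^ k] (mod int r) \<Longrightarrow>
      [(1 + y) ^ k = (1 + x) ^ k] (mod int r) \<Longrightarrow> [(1 + z) ^ k = (1 + x) ^ k] (mod int r) \<Longrightarrow>
      x = y \<or> x = z \<or> y = z"
    and E2: "\<And>r x y z. prime r \<Longrightarrow> r \<notin> E2 \<Longrightarrow> 2 * k dvd r - 1 \<Longrightarrow>
      x \<in> {0<..<int r - 1} \<Longrightarrow> y \<in> {0<..<int r - 1} \<Longrightarrow> z \<in> {0<..<int r - 1} \<Longrightarrow>
      [y ^ (2 * k) = x ^ (2 * k)] (mod int r) \<Longrightarrow> [z ^ (2 * k) = x ^ (2 * k)] (mod int r) \<Longrightarrow>
      [(1 + y) ^ (2 * k) = (1 + x) ^ (2 * k)] (mod int r) \<Longrightarrow>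
      [(1 + z) ^ (2 * k) = (1 + x) ^ (2 * k)] (mod int r) \<Longrightarrow> x = y \<or> x = z \<or> y = z"
  proof -
    have "2 * k \<ge> 1" using assms by simp
    obtain E1 where "finite E1" and E1: "\<forall>r x y z. prime r \<longrightarrow> r \<notin> E1 \<longrightarrow> k dvd r - 1 \<longrightarrow>
      x \<in> {0<..<int r - 1} \<longrightarrow> y \<in> {0<..<int r - 1} \<longrightarrow> z \<in> {0<..<int r - 1} \<longrightarrow>
      [y ^ k = x ^ k] (mod int r) \<longrightarrow> [z ^ k = x ^ k] (mod int r) \<longrightarrow>
      [(1 + y) ^ k = (1 + x) ^ k] (mod int r) \<longrightarrow> [(1 + z) ^ k = (1 + x) ^ k] (mod int r) \<longrightarrow>
      x = y \<or> x = z \<or> y = z"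
      using no_three_with_equal_powers[OF assms] by (elim exE conjE)
    obtain E2 where "finite E2" and E2: "\<forall>r x y z. prime r \<longrightarrow> r \<notin> E2 \<longrightarrow> 2 * k dvd r - 1 \<longrightarrow>
      x \<in> {0<..<int r - 1} \<longrightarrow> y \<in> {0<..<int r - 1} \<longrightarrow> z \<in> {0<..<int r - 1} \<longrightarrow>
      [y ^ (2 * k) = x ^ (2 * k)] (mod int r) \<longrightarrow> [z ^ (2 * k) = x ^ (2 * k)] (mod int r) \<longrightarrow>
      [(1 + y) ^ (2 * k) = (1 + x) ^ (2 * k)] (mod int r) \<longrightarrow>
      [(1 + z) ^ (2 * k) = (1 + x) ^ (2 * k)] (mod int r) \<longrightarrow> x = y \<or> x = z \<or> y = z"
      using no_three_with_equal_powers[OF \<open>2 * k \<ge> 1\<close>] by (elim exE conjE)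
    show thesis by (rule that[OF \<open>finite E1\<close> \<open>finite E2\<close>]; use E1 E2 in simp)
  qed
  define E where "E = {r \<in> E1 \<union> E2. prime r}"
  have setting: "generic_period_setting n k r q K"
    if h: "n > 1" "r = n * k + 1" "prime r" "r \<notin> E" "\<not> r dvd q"
      "subgroup K (Zmod_units r)" "card K = k"
      "generate (Zmod_units r) (insert (residue_class r q) K) = carrier (Zmod_units r)"
    for n r q K
  proof -
    interpret period_setting n k r q K by (rule period_setting.intro; fact)
    have nE: "r \<notin> E1" "r \<notin> E2" using h(3,4) by (auto simp: E_def)
    show ?thesis
    proof unfold_locales
      fix x y z :: int and M
      assume *: "x \<in> S" "y \<in> S" "z \<in> S" "M = k \<or> M = 2 * k" "M dvd r - 1"
        "[y ^ M = x ^ M] (mod int r)" "[z ^ M = x ^ M] (mod int r)"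
        "[(1 + y) ^ M = (1 + x) ^ M] (mod int r)" "[(1 + z) ^ M = (1 + x) ^ M] (mod int r)"
      from *(4) show "x = y \<or> x = z \<or> y = z"
      proof
        assume "M = k"
        then show ?thesis using E1[OF h(3) nE(1) _ *(1-3)[unfolded S_def]] *(5-9) by simp
      next
        assume "M = 2 * k"
        then show ?thesis using E2[OF h(3) nE(2) _ *(1-3)[unfolded S_def]] *(5-9) by simp
      qed
    qed
  qed
  show ?thesis
  proof (intro exI[of _ E] conjI[of "finite E"] conjI[of "\<forall>e\<in>E. prime e"] allI impI)
    show "finite E" "\<forall>e\<in>E. prime e" using fin by (auto simp: E_def)
  next
    fix n r p m q :: nat and K :: "int set"
    assume h: "n > 1 \<and> r = n * k + 1 \<and> prime r \<and> r \<notin> E \<and>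
      prime p \<and> m \<ge> 1 \<and> q = p ^ m \<and> \<not> r dvd q \<and>
      subgroup K (Zmod_units r) \<and> card K = k \<and>
      generate (Zmod_units r) (insert (residue_class r q) K) = carrier (Zmod_units r)"
    then interpret generic_period_setting n k r q K by (intro setting) (elim conjE; assumption)+
    have "\<forall>i<n. \<forall>j<n. cyclotomic_number r q K i j \<le> 2"
      using t_le_2 by (simp add: cyclotomic_number_t)
    then show "(\<forall>i<n. \<forall>j<n. cyclotomic_number r q K i j \<le> 2) \<and>
      (even k \<longrightarrow>
        (p = 2 \<longrightarrow>
          real (complexity n k p q K) = real n * real k - real k ^ 2 + 3 * real k - 3) \<and>
        (p > 2 \<and> [k = 0] (mod p) \<longrightarrow>
          real (complexity n k p q K) =
            real n * real k - 1/2 * real k ^ 2 + 3/2 * real k - 2) \<and>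
        (p > 2 \<and> [k = 1] (mod p) \<longrightarrow>
          real (complexity n k p q K) =
            real n * (real k + 1) - 1/2 * real k ^ 2 + real k - 3) \<and>
        (p > 2 \<and> [k = 2] (mod p) \<longrightarrow>
          real (complexity n k p q K) =
            real n * (real k + 1) - 1/2 * real k ^ 2 + 1/2 * real k - 1) \<and>
        (p > 2 \<and> \<not> [k = 0] (mod p) \<and> \<not> [k = 1] (mod p) \<and> \<not> [k = 2] (mod p) \<longrightarrow>
          real (complexity n k p q K) =
            real n * (real k + 1) - 1/2 * real k ^ 2 + real k - 2)) \<and>
      (odd k \<longrightarrow>
        (p = 2 \<longrightarrow>
          real (complexity n k p q K) = real n * (real k + 1) - real k ^ 2 + real k - 1) \<and>
        (p > 2 \<and> [k = 0] (mod p) \<longrightarrow>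
          real (complexity n k p q K) =
            real n * real k - 1/2 * real k ^ 2 + 3/2 * real k - 2) \<and>
        (p > 2 \<and> [k = 1] (mod p) \<longrightarrow>
          real (complexity n k p q K) =
            real n * (real k + 1) - 1/2 * real k ^ 2 - 1/2 * real k) \<and>
        (p > 2 \<and> \<not> [k = 0] (mod p) \<and> \<not> [k = 1] (mod p) \<longrightarrow>
          real (complexity n k p q K) =
            real n * (real k + 1) - 1/2 * real k ^ 2 + 1/2 * real k - 1))"
      by (rule conjI) (rule conjI; rule complexity_formulas)
  qed
qed

end
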